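(* Let $\Omega=(-B,B)^d\subset\mathbb{R}^d$ with $B>0$, let $k$ be the Matérn kernel with scale $\sigma^2>0$, length scale $\ell>0$ and fixed smoothness $\nu>d/2$, and let $\gamma\in(0,1)$. There exist a constant $h_0>0$ (determined by the interior cone condition of $\Omega$) and a constant $c>0$, independent of $N$, $\mathbf{X}_N$ and $\mathbf{t}$, such that for every set $\mathbf{X}_N=\{\mathbf{x}_1,\dots,\mathbf{x}_N\}\subset\Omega$ of distinct points with fill distance $h_N\le h_0$ and every $\mathbf{t}\in\Omega$ with $\min_{1\le i\le N}\|\mathbf{t}-\mathbf{x}_i\|_2\ge\gamma h_N$, $$P_N^2(\mathbf{t})\ge c\,h_N^{2\nu}.$$
   Context: Matérn kernel: $k(\mathbf{x},\mathbf{x}')=\sigma^2\frac{2^{1-\nu}}{\Gamma(\nu)}\left(\frac{\sqrt{2\nu}\|\mathbf{x}-\mathbf{x}'\|_2}{\ell}\right)^\nu K_\nu\left(\frac{\sqrt{2\nu}\|\mathbf{x}-\mathbf{x}'\|_2}{\ell}\right)$ (equal to $\sigma^2$ when $\mathbf{x}=\mathbf{x}'$), $K_\nu$ the modified Bessel function of the second kind. Fill distance: $h_N:=\sup_{\mathbf{x}\in\Omega}\min_{1\le i\le N}\|\mathbf{x}-\mathbf{x}_i\|_2$. Power function: with $\mathbf{k}_N(\mathbf{t}):=[k(\mathbf{t},\mathbf{x}_1),\ldots,k(\mathbf{t},\mathbf{x}_N)]^{T}$ and $\mathbf{K}_N:=(k(\mathbf{x}_i,\mathbf{x}_j))_{i,j}$,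 $P_N^2(\mathbf{t}):=k(\mathbf{t},\mathbf{t})-\mathbf{k}_N^{T}(\mathbf{t})\mathbf{K}_N^{-1}\mathbf{k}_N(\mathbf{t})$. The constant $c$ may depend on $d,\nu,\ell,\sigma^2,B,\gamma$. The threshold $h_0$ depends only on the geometry of the domain. *)

theory Defs
  imports
    "HOL-Analysis.Analysis"
    "Jordan_Normal_Form.Gauss_Jordan_Elimination"
begin

(* The classical integral representation, valid for every real order nu and every z > 0;
   the value at z = 0 (where K has a singularity) is irrelevant and never used below. *)
definition bessel_K :: "real \<Rightarrow> real \<Rightarrow> real" where
  "bessel_K \<nu> z = (LBINT t:{0..}. exp (- z * cosh t) * cosh (\<nu> * t))"

definition matern :: "real \<Rightarrow> real \<Rightarrow> real \<Rightarrow> real ^ 'd \<Rightarrow> real ^ 'd \<Rightarrow> real" where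
  "matern \<nu> \<sigma> l x y =
     (if x = y then \<sigma>\<^sup>2
      else \<sigma>\<^sup>2 * (2 powr (1 - \<nu>) / Gamma \<nu>)
             * (sqrt (2 * \<nu>) * norm (x - y) / l) powr \<nu>
             * bessel_K \<nu> (sqrt (2 * \<nu>) * norm (x - y) / l))"

definition cube :: "real \<Rightarrow> (real ^ 'd) set" where
  "cube B = box (\<chi> i. - B) (\<chi> i. B)"

(* In the notions below, the N design points are x 0, ..., x (N - 1). *)

definition min_dist :: "nat \<Rightarrow> (nat \<Rightarrow> real ^ 'd) \<Rightarrow> real ^ 'd \<Rightarrow> real" where
  "min_dist N x t = (MIN i\<in>{..<N}. norm (t - x i))"

definition fill_distance :: "(real ^ 'd) set \<Rightarrow> nat \<Rightarrow> (nat \<Rightarrow> real ^ 'd) \<Rightarrow> real" where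
  "fill_distance \<Omega> N x = (SUP t\<in>\<Omega>. min_dist N x t)"

definition kernel_vec :: "('p \<Rightarrow> 'p \<Rightarrow> real) \<Rightarrow> nat \<Rightarrow> (nat \<Rightarrow> 'p) \<Rightarrow> 'p \<Rightarrow> real Matrix.vec" where
  "kernel_vec k N x t = Matrix.vec N (\<lambda>i. k t (x i))"

definition kernel_mat :: "('p \<Rightarrow> 'p \<Rightarrow> real) \<Rightarrow> nat \<Rightarrow> (nat \<Rightarrow> 'p) \<Rightarrow> real mat" where
  "kernel_mat k N x = Matrix.mat N N (\<lambda>(i, j). k (x i) (x j))"

(* The square of the power function.  mat_inverse returns None exactly for singular matrices,
   where the value is unspecified. *)
definition power_function_sq ::
  "('p \<Rightarrow> 'p \<Rightarrow> real) \<Rightarrow> nat \<Rightarrow> (nat \<Rightarrow> 'p) \<Rightarrow> 'p \<Rightarrow> real" where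
  "power_function_sq k N x t =
     k t t - scalar_prod (kernel_vec k N x t)
               (the (mat_inverse (kernel_mat k N x)) *\<^sub>v kernel_vec k N x t)"

end

theory Submission
  imports Defs "HOL-Probability.Probability" "Jordan_Normal_Form.Determinant"
begin

text \<open>
  For any coefficients $a_i$ and points $y_i$ the quadratic form
  $Q(a) = \sum_{i,j} a_i a_j k(y_i, y_j)$ is the squared norm of the functional
  $f \mapsto \sum_i a_i f(y_i)$ on the native space of the kernel $k$. If $f$ is a function in that
  space with $f(y_0) = 1$ and $f(y_i) = 0$ for $i \ne 0$, then $a_0^2 \le Q(a) \|f\|^2$. The
  squared power function at $t$ is $Q(a)$ for the points $t, x_1, \dots, x_N$ and certain
  coefficients with $a_0 = 1$ at $t$ (\<open>power_function_sq_eq_quadratic_form\<close>). All design points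
  lie at distance at least $\delta = \gamma h_N$ from $t$, so a bump function supported in the ball of
  radius $\delta$ about $t$ serves as $f$. The native space of the Matern kernel is a Sobolev space
  of order $\nu + d/2$, hence scaling the bump to radius $\delta$ makes $\|f\|^2$ of order
  $\delta^{-2\nu}$, and the lower bound $Q(a) \ge c \delta^{2\nu}$ follows.

  The argument is carried out on the Fourier side. The kernel
  is a mixture of Gaussians over a Gamma distributed variance (\<open>matern_eq_matern_mix\<close>), which
  exhibits it as the transform of an explicit positive density $W$ (\<open>matern_mix_fourier\<close>). The bump
  is a tensor product of B-splines, the inverse transform of
  $\Phi(s) = \prod_j (\sin s_j / s_j)^m$ with a large even exponent $m$. The transform of $\Phi$
  is positive at the origin because $m$ is even, and it vanishes outside a cube because the transform
  of each factor has compact support (\<open>sinc_power_fourier_vanishes\<close>). The inequality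
  $a_0^2 \le Q(a) \|f\|^2$ becomes the Cauchy-Schwarz inequality for $\int \Phi C$ with weight
  $W$, where $C(s) = \sum_i a_i \cos(s \cdot (y_i - y_0))$ (\<open>matern_mix_quadratic_form_lower\<close>). The scaling of the bump is replaced by a scaling of the
  points, which only changes the parameter of the Gaussian mixture
  (\<open>matern_quadratic_form_lower\<close>).

  The same lower bound, applied at a tiny scale around one of the design points, shows that the
  kernel matrix is invertible (\<open>matern_kernel_mat_det_nonzero\<close>). The constant $c$ is uniform
  over all scales $\delta \le 1$, and $\delta < h_N$; this is why $h_0 = 1$ is taken as the threshold.
\<close>

section \<open>Fourier transforms of even product weights\<close>

lemma integral_odd_eq_0:
  fixes f :: "real \<Rightarrow> real"
  assumes "\<And>x. f (- x) = - f x"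
  shows "(LINT x|lborel. f x) = 0"
proof -
  have "(LINT x|lborel. f x) = (LINT x|lborel. f (0 + (- 1) * x))"
    by (subst lborel_integral_real_affine[where c = "- 1" and t = 0]) simp_all
  also have "\<dots> = - (LINT x|lborel. f x)"
    by (simp add: assms)
  finally show ?thesis by simp
qed

text \<open>
A product of one-dimensional weights has a Fourier transform that factorises over the coordinates.
The complex exponential is used because it is multiplicative; since the weight is even, its sine
transform vanishes and only real cosine transforms remain in the statement.
\<close>

lemma fourier_cos_tensor:
  fixes h :: "real \<Rightarrow> real" and z :: "real ^ 'd"
  assumes h: "integrable lborel h" and even: "\<And>s. h (- s) = h s"
  defines "\<mu> \<equiv> Pi\<^sub>M (UNIV :: 'd set) (\<lambda>_. lborel)"
  shows "integrable \<mu> (\<lambda>s. (\<Prod>j\<in>UNIV. h (s j)) * cos (\<Sum>j\<in>UNIV. s j * vec_nth z j))"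
    and "(LINT s|\<mu>. (\<Prod>j\<in>UNIV. h (s j)) * cos (\<Sum>j\<in>UNIV. s j * vec_nth z j))
         = (\<Prod>j\<in>UNIV. LINT s|lborel. h s * cos (s * vec_nth z j))"
proof -
  interpret product_sigma_finite "\<lambda>_ :: 'd. lborel :: real measure" ..
  define H where "H j s = complex_of_real (h s) * cis (s * vec_nth z j)" for j s
  have [measurable]: "h \<in> borel_measurable borel"
    using borel_measurable_integrable[OF h] by simp
  have H_int: "integrable lborel (H j)" for j
  proof (rule Bochner_Integration.integrable_bound[OF h])
    show "H j \<in> borel_measurable lborel"
      unfolding H_def cis_conv_exp by measurable
  qed (simp add: H_def norm_mult)
  have prod_eq: "(\<Prod>j\<in>UNIV. H j (s j))
      = complex_of_real (\<Prod>j\<in>UNIV. h (s j)) * cis (\<Sum>j\<in>UNIV. s j * vec_nth z j)" for s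
    by (simp add: H_def prod.distrib cis_conv_exp exp_sum sum_distrib_left)
  have Re_eq: "Re (\<Prod>j\<in>UNIV. H j (s j))
      = (\<Prod>j\<in>UNIV. h (s j)) * cos (\<Sum>j\<in>UNIV. s j * vec_nth z j)" for s
    unfolding prod_eq by (simp del: of_real_prod)
  have P_int: "integrable \<mu> (\<lambda>s. \<Prod>j\<in>UNIV. H j (s j))"
    unfolding \<mu>_def by (rule product_integrable_prod) (auto intro: H_int)
  show "integrable \<mu> (\<lambda>s. (\<Prod>j\<in>UNIV. h (s j)) * cos (\<Sum>j\<in>UNIV. s j * vec_nth z j))"
    using integrable_Re[OF P_int] unfolding Re_eq .
  have one_dim: "(LINT s|lborel. H j s) = complex_of_real (LINT s|lborel. h s * cos (s * vec_nth z j))" for j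
  proof (rule complex_eqI)
    show "Re (LINT s|lborel. H j s) = Re (complex_of_real (LINT s|lborel. h s * cos (s * vec_nth z j)))"
      by (subst integral_Re[OF H_int, symmetric]) (simp add: H_def)
    show "Im (LINT s|lborel. H j s) = Im (complex_of_real (LINT s|lborel. h s * cos (s * vec_nth z j)))"
      by (subst integral_Im[OF H_int, symmetric]) (simp add: H_def integral_odd_eq_0 even)
  qed
  have "(LINT s|\<mu>. (\<Prod>j\<in>UNIV. h (s j)) * cos (\<Sum>j\<in>UNIV. s j * vec_nth z j))
      = Re (LINT s|\<mu>. (\<Prod>j\<in>UNIV. H j (s j)))"
    by (subst integral_Re[OF P_int, symmetric]) (simp only: Re_eq)
  also have "(LINT s|\<mu>. (\<Prod>j\<in>UNIV. H j (s j))) = (\<Prod>j\<in>UNIV. LINT s|lborel. H j s)"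
    unfolding \<mu>_def by (rule product_integral_prod) (auto intro: H_int)
  also have "\<dots> = complex_of_real (\<Prod>j\<in>UNIV. LINT s|lborel. h s * cos (s * vec_nth z j))"
    by (simp add: one_dim)
  finally show "(LINT s|\<mu>. (\<Prod>j\<in>UNIV. h (s j)) * cos (\<Sum>j\<in>UNIV. s j * vec_nth z j))
         = (\<Prod>j\<in>UNIV. LINT s|lborel. h s * cos (s * vec_nth z j))"
    by (simp only: Re_complex_of_real)
qed

section \<open>Powers of the cardinal sine have compactly supported transforms\<close>

lemma integrable_inverse_1_plus_square_UNIV: "integrable lborel (\<lambda>x :: real. inverse (1 + x\<^sup>2))"
  using integrable_inverse_1_plus_square by (simp add: set_integrable_def einterval_def)

text \<open>
The square of the cardinal sine is bounded by $1$ and by $1/s^2$; the sum of the two bounds is used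
here, because it supplies an integrable majorant that also absorbs polynomial weights.
\<close>

lemma sinc_square_le: "(sinc s)\<^sup>2 \<le> 2 * inverse (1 + s\<^sup>2)"
proof -
  have "(sinc s)\<^sup>2 * (1 + s\<^sup>2) \<le> 2"
  proof (cases "s = 0")
    case False
    have "(sinc s)\<^sup>2 \<le> 1"
      using abs_sin_x_le_abs_x[of s] False by (simp add: power_divide abs_le_square_iff)
    moreover have "(sinc s)\<^sup>2 * s\<^sup>2 \<le> 1"
      using False by (simp add: power_divide abs_square_le_1)
    ultimately show ?thesis by (simp add: distrib_left)
  qed simp
  moreover have "0 < 1 + s\<^sup>2" by (simp add: add_pos_nonneg)
  ultimately show ?thesis by (simp add: field_simps)
qed

lemma abs_sinc_le_1: "\<bar>sinc s\<bar> \<le> 1"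
  using abs_sin_x_le_abs_x[of s] by (simp add: divide_le_eq_1)

lemma integrable_sinc_power:
  assumes "2 \<le> m"
  shows "integrable lborel (\<lambda>s. sinc s ^ m)"
proof (rule Bochner_Integration.integrable_bound)
  show "integrable lborel (\<lambda>s :: real. 2 * inverse (1 + s\<^sup>2))"
    using integrable_inverse_1_plus_square_UNIV by simp
  have "norm (sinc s ^ m) \<le> norm (2 * inverse (1 + s\<^sup>2))" for s
  proof -
    have "norm (sinc s ^ m) = \<bar>sinc s\<bar> ^ m" by (simp only: real_norm_def power_abs)
    also have "\<dots> \<le> \<bar>sinc s\<bar> ^ 2"
      by (rule power_decreasing[OF assms abs_ge_zero abs_sinc_le_1])
    also have "\<dots> \<le> 2 * inverse (1 + s\<^sup>2)"
      using sinc_square_le[of s] by (simp only: power2_abs)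
    also have "\<dots> \<le> norm (2 * inverse (1 + s\<^sup>2))" by simp
    finally show ?thesis .
  qed
  then show "AE s in lborel. norm (sinc s ^ m) \<le> norm (2 * inverse (1 + s\<^sup>2))" by blast
qed measurable


lemma one_minus_cos_eq: "(1 :: real) - cos x = 2 * (sin (x / 2))\<^sup>2"
  using cos_double_sin[of "x / 2"] by simp

lemma one_minus_cos_AE: "AE s in lborel. (1 - cos s) / s\<^sup>2 = (1/2) * (sinc (0 + (1/2) * s))\<^sup>2"
proof -
  have "(1 - cos s) / s\<^sup>2 = (1/2) * (sinc (0 + (1/2) * s))\<^sup>2" if "s \<noteq> 0" for s :: real
    unfolding one_minus_cos_eq using that by (simp add: power_divide)
  then show ?thesis
    using AE_lborel_singleton[of "0 :: real"] by (auto elim: AE_mp)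
qed

text \<open>
The substitution $s \mapsto bs$ shows that the integral is proportional to $|b|$. The
constant of proportionality is $\pi$; in the next lemma it multiplies an expression that is zero.
\<close>

lemma integrable_one_minus_cos:
  "integrable lborel (\<lambda>s :: real. (1 - cos (b * s)) / s\<^sup>2)"
  and integral_one_minus_cos:
  "(LINT s|lborel. (1 - cos (b * s)) / s\<^sup>2) = \<bar>b\<bar> * (LINT s|lborel. (1 - cos s) / s\<^sup>2)"
proof -
  have "integrable lborel (\<lambda>s. (1/2) * (sinc (0 + (1/2) * s))\<^sup>2)"
    using lborel_integrable_real_affine[OF integrable_sinc_power[of 2], of "1/2" 0] by simp
  then have 1: "integrable lborel (\<lambda>s :: real. (1 - cos s) / s\<^sup>2)"
    by (subst integrable_cong_AE[OF _ _ one_minus_cos_AE]) auto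
  have scale: "(1 - cos (b * s)) / s\<^sup>2 = b\<^sup>2 * ((1 - cos (0 + b * s)) / (0 + b * s)\<^sup>2)" for s
    by (cases "b = 0") (simp_all add: power_mult_distrib)
  show "integrable lborel (\<lambda>s :: real. (1 - cos (b * s)) / s\<^sup>2)"
  proof (cases "b = 0")
    case False
    then show ?thesis
      unfolding scale using lborel_integrable_real_affine[OF 1 False, of 0]
      by (intro integrable_mult_right) simp
  qed simp
  show "(LINT s|lborel. (1 - cos (b * s)) / s\<^sup>2) = \<bar>b\<bar> * (LINT s|lborel. (1 - cos s) / s\<^sup>2)"
  proof (cases "b = 0")
    case False
    have "(LINT s|lborel. (1 - cos (b * s)) / s\<^sup>2)
        = b\<^sup>2 * (LINT s|lborel. (1 - cos (0 + b * s)) / (0 + b * s)\<^sup>2)"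
      unfolding scale by (rule integral_mult_right_zero)
    also have "\<dots> = \<bar>b\<bar> * (\<bar>b\<bar> * (LINT s|lborel. (1 - cos (0 + b * s)) / (0 + b * s)\<^sup>2))"
      by (simp add: power2_eq_square flip: mult.assoc)
    also have "\<bar>b\<bar> * (LINT s|lborel. (1 - cos (0 + b * s)) / (0 + b * s)\<^sup>2) = (LINT s|lborel. (1 - cos s) / s\<^sup>2)"
      by (subst (2) lborel_integral_real_affine[OF False, of _ 0]) simp
    finally show ?thesis .
  qed simp
qed

text \<open>
The transform is a multiple of the tent function $\frac14 |y+2| + \frac14 |y-2| - \frac12 |y|$, a
second difference of $|y|$, which vanishes where the arguments of the three absolute values have the
same sign.
\<close>

lemma sinc_square_fourier_vanishes:
  assumes "2 \<le> \<bar>y\<bar>"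
  shows "(LINT s|lborel. (sinc s)\<^sup>2 * cos (s * y)) = 0"
proof -
  define \<kappa> where "\<kappa> = (LINT s|lborel. (1 - cos s) / s\<^sup>2 :: real)"
  have pt: "(sinc s)\<^sup>2 * cos (s * y) = (1/4) * ((1 - cos ((y + 2) * s)) / s\<^sup>2)
      + (1/4) * ((1 - cos ((y - 2) * s)) / s\<^sup>2) - (1/2) * ((1 - cos (y * s)) / s\<^sup>2)"
    if "s \<noteq> 0" for s
  proof -
    have "cos ((y + 2) * s) = cos (y * s) * cos (2 * s) - sin (y * s) * sin (2 * s)"
         "cos ((y - 2) * s) = cos (y * s) * cos (2 * s) + sin (y * s) * sin (2 * s)"
      by (simp_all only: distrib_right left_diff_distrib cos_add cos_diff)
    then have "(1/4) * (1 - cos ((y + 2) * s)) + (1/4) * (1 - cos ((y - 2) * s)) - (1/2) * (1 - cos (y * s))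
       = (sin s)\<^sup>2 * cos (s * y)"
      unfolding cos_double_sin by (simp add: algebra_simps)
    moreover have "(sinc s)\<^sup>2 * cos (s * y) = (sin s)\<^sup>2 * cos (s * y) / s\<^sup>2"
      using that by (simp add: power_divide)
    ultimately show ?thesis
      by (simp only: times_divide_eq_right flip: add_divide_distrib diff_divide_distrib)
  qed
  have "(LINT s|lborel. (sinc s)\<^sup>2 * cos (s * y))
     = (LINT s|lborel. (1/4) * ((1 - cos ((y + 2) * s)) / s\<^sup>2)
      + (1/4) * ((1 - cos ((y - 2) * s)) / s\<^sup>2) - (1/2) * ((1 - cos (y * s)) / s\<^sup>2))"
  proof (rule integral_cong_AE)
    show "AE s in lborel. (sinc s)\<^sup>2 * cos (s * y) = (1/4) * ((1 - cos ((y + 2) * s)) / s\<^sup>2)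
      + (1/4) * ((1 - cos ((y - 2) * s)) / s\<^sup>2) - (1/2) * ((1 - cos (y * s)) / s\<^sup>2)"
      using AE_lborel_singleton[of "0 :: real"] by eventually_elim (rule pt)
  qed measurable
  also have "\<dots> = (1/4) * (\<bar>y + 2\<bar> * \<kappa>) + (1/4) * (\<bar>y - 2\<bar> * \<kappa>) - (1/2) * (\<bar>y\<bar> * \<kappa>)"
    unfolding \<kappa>_def integral_one_minus_cos[symmetric]
    by (simp only: Bochner_Integration.integral_diff Bochner_Integration.integral_add Bochner_Integration.integrable_add integrable_mult_right
          integrable_one_minus_cos integral_mult_right_zero)
  also have "\<dots> = \<kappa> * (1/4 * \<bar>y + 2\<bar> + 1/4 * \<bar>y - 2\<bar> - 1/2 * \<bar>y\<bar>)"
    by (simp add: algebra_simps)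
  also have "1/4 * \<bar>y + 2\<bar> + 1/4 * \<bar>y - 2\<bar> - 1/2 * \<bar>y\<bar> = 0"
    using assms by (cases "0 \<le> y") (simp_all add: field_simps)
  finally show ?thesis by simp
qed


lemma sinc_eq_integral_cos:
  "sinc s = (1/2) * (LINT r|lborel. indicator {-1..1} r * cos (s * r))"
proof (cases "s = 0")
  case True
  then show ?thesis by (simp add: measure_def)
next
  case False
  have "(LINT r|lborel. cos (s * r) * indicator {-1..1} r) = sin (s * 1) / s - sin (s * (- 1)) / s"
    by (rule integral_FTC_Icc_real[where F = "\<lambda>r. sin (s * r) / s"])
       (use False in \<open>auto intro!: derivative_eq_intros continuous_intros\<close>)
  then show ?thesis
    using False by (simp add: mult.commute)
qed

text \<open>
Powers of the cardinal sine are transforms of B-splines. Writing one factor as the mean of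
$\cos(sr)$ over $|r| \le 1$ turns the transform of the next power into the mean of the previous
transform over the interval of radius $1$ about $y$, so each factor enlarges the support by $1$.
The induction starts at exponent $2$, the first for which the integrals converge absolutely.
\<close>

lemma sinc_power_fourier_vanishes:
  assumes "2 \<le> m" "real m \<le> \<bar>y\<bar>"
  shows "(LINT s|lborel. sinc s ^ m * cos (s * y)) = 0"
  using assms
proof (induction m arbitrary: y rule: nat_induct_at_least)
  case base
  then show ?case using sinc_square_fourier_vanishes by simp
next
  case (Suc m)
  define f where "f s r = sinc s ^ m * cos (s * y) * (indicator {-1..1 :: real} r * cos (s * r))" for s r
  have int_m: "integrable lborel (\<lambda>s. sinc s ^ m * cos (s * b))" for b
    by (rule Bochner_Integration.integrable_bound[OF integrable_sinc_power[OF Suc.hyps]])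
       (auto simp: abs_mult intro!: mult_left_le)
  have f_int: "integrable (lborel \<Otimes>\<^sub>M lborel) (case_prod f)"
  proof (rule Bochner_Integration.integrable_bound)
    show "integrable (lborel \<Otimes>\<^sub>M lborel) (\<lambda>(s, r). sinc s ^ m * indicator {-1..1 :: real} r)"
      by (rule lborel_pair.Fubini_integrable)
         (auto simp: abs_mult intro!: integrable_abs integrable_sinc_power[OF Suc.hyps]
            simp del: power_divide)
    show "AE p in lborel \<Otimes>\<^sub>M lborel. norm (case p of (s, r) \<Rightarrow> f s r)
        \<le> norm (case p of (s, r) \<Rightarrow> sinc s ^ m * indicator {-1..1 :: real} r)"
      by (intro AE_I2)
         (auto simp: f_def abs_mult mult.assoc split: split_indicator intro!: mult_left_le mult_le_one)
    show "(\<lambda>(s, r). f s r) \<in> borel_measurable (lborel \<Otimes>\<^sub>M lborel)"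
      unfolding f_def by measurable
  qed
  have inner: "(LINT s|lborel. f s r) = 0" for r
  proof (cases "r \<in> {-1..1}")
    case True
    have "real m \<le> \<bar>y + r\<bar>" "real m \<le> \<bar>y - r\<bar>"
      using True Suc.prems by auto
    then have "(LINT s|lborel. sinc s ^ m * cos (s * (y + r))) = 0"
         "(LINT s|lborel. sinc s ^ m * cos (s * (y - r))) = 0"
      by (auto intro: Suc.IH simp del: power_divide)
    moreover have "f s r = (1/2) * (sinc s ^ m * cos (s * (y + r))) + (1/2) * (sinc s ^ m * cos (s * (y - r)))" for s
      using True by (simp add: f_def algebra_simps cos_add cos_diff)
    ultimately show ?thesis
      using int_m by (simp only: Bochner_Integration.integral_add integrable_mult_right integral_mult_right_zero)
  qed (simp add: f_def)
  have "(LINT s|lborel. sinc s ^ Suc m * cos (s * y)) = (LINT s|lborel. (1/2) * (LINT r|lborel. f s r))"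
  proof (rule Bochner_Integration.integral_cong[OF refl])
    fix s
    have "sinc s ^ Suc m * cos (s * y) = sinc s ^ m * cos (s * y) * sinc s"
      by (simp only: power_Suc mult.commute mult.left_commute)
    also have "\<dots> = (1/2) * (LINT r|lborel. f s r)"
      unfolding f_def integral_mult_right_zero by (subst (2) sinc_eq_integral_cos) (simp only: mult.left_commute)
    finally show "sinc s ^ Suc m * cos (s * y) = (1/2) * (LINT r|lborel. f s r)" .
  qed
  also have "\<dots> = (1/2) * (LINT r|lborel. (LINT s|lborel. f s r))"
    by (subst lborel_pair.Fubini_integral[OF f_int]) (rule integral_mult_right_zero)
  finally show ?case
    by (simp add: inner)
qed

lemma sinc_power_integral_pos:
  assumes "2 \<le> m" "even m"
  shows "0 < (LINT s|lborel. sinc s ^ m)"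
proof -
  have nonneg: "0 \<le> sinc s ^ m" for s
    using assms(2) by (rule zero_le_even_power)
  have "(LINT s|lborel. sinc s ^ m) \<noteq> 0"
  proof
    assume "(LINT s|lborel. sinc s ^ m) = 0"
    then have "AE s in lborel. sinc s ^ m = 0"
      using integral_nonneg_eq_0_iff_AE[OF integrable_sinc_power[OF assms(1)]] nonneg by simp
    then have "AE s in lborel. s \<notin> {0<..<1 :: real}"
    proof eventually_elim
      case (elim s)
      have "s < pi" if "s < 1" using that pi_gt3 by linarith
      then show ?case
        using elim sin_gt_zero[of s] by (auto split: if_splits)
    qed
    then have "emeasure lborel {0<..<1 :: real} = 0"
      by (subst (asm) AE_iff_measurable[where N = "{0<..<1}"]) auto
    then show False by simp
  qed
  moreover have "0 \<le> (LINT s|lborel. sinc s ^ m)"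
    by (rule Bochner_Integration.integral_nonneg) (rule nonneg)
  ultimately show ?thesis by simp
qed

section \<open>Gaussian and Gamma integrals\<close>

text \<open>
The real part of the characteristic function of the standard normal distribution, rescaled.
\<close>

lemma normal_density_fourier:
  assumes "0 < \<tau>"
  shows "(LINT s|lborel. normal_density 0 \<tau> s * cos (s * y)) = exp (- (\<tau>\<^sup>2 * y\<^sup>2) / 2)"
proof -
  have std: "(LINT s|lborel. std_normal_density s * cos (t * s)) = exp (- (t\<^sup>2) / 2)" for t
  proof -
    interpret real_distribution std_normal_distribution
      by (rule real_dist_normal_dist)
    have int: "integrable std_normal_distribution (\<lambda>s. iexp (t * s))"
      by (rule integrable_iexp) simp_all
    have "exp (- (t\<^sup>2) / 2) = Re (char std_normal_distribution t)"
      by (simp add: char_std_normal_distribution)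
    also have "\<dots> = (LINT s|std_normal_distribution. Re (iexp (t * s)))"
      unfolding char_def by (rule integral_Re[OF int, symmetric])
    also have "\<dots> = (LINT s|std_normal_distribution. cos (t * s))"
      by (simp add: Re_exp)
    also have "\<dots> = (LINT s|lborel. std_normal_density s * cos (t * s))"
      by (subst integral_density) auto
    finally show ?thesis by simp
  qed
  have "(LINT s|lborel. normal_density 0 \<tau> s * cos (s * y))
      = \<tau> * (LINT s|lborel. normal_density 0 \<tau> (0 + \<tau> * s) * cos ((0 + \<tau> * s) * y))"
    using assms by (subst lborel_integral_real_affine[of \<tau> _ 0]) simp_all
  also have "\<dots> = (LINT s|lborel. std_normal_density s * cos ((\<tau> * y) * s))"
    unfolding integral_mult_right_zero[symmetric]
    by (rule Bochner_Integration.integral_cong)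
       (use assms in \<open>simp_all add: normal_density_def real_sqrt_mult power_mult_distrib mult_ac\<close>)
  finally show ?thesis
    by (simp add: std power_mult_distrib)
qed

lemma sum_square_eq_norm: "(\<Sum>j\<in>UNIV. (vec_nth z j)\<^sup>2) = (norm (z :: real ^ 'd))\<^sup>2"
  by (simp add: norm_vec_def L2_set_def sum_nonneg)

text \<open>
Euler's integral in the variable $v = \ln u$. On this logarithmic scale the substitutions needed
below, for the scaling constant $c$ and for the Bessel function, are mere translations.
\<close>

lemma gamma_integral_exp:
  fixes p c :: real
  assumes "0 < p" "0 < c"
  shows "has_bochner_integral lborel (\<lambda>v. exp (p * v - c * exp v)) (Gamma p * c powr (- p))"
proof -
  define f where "f t = t powr (p - 1) / exp t" for t :: real
  have "(f has_integral Gamma p) {0..}"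
    unfolding f_def by (rule Gamma_integral_real[OF assms(1)])
  then have f: "(f has_integral Gamma p) {0<..}"
    by (rule iffD1[OF has_integral_spike_set_eq, rotated 2])
       (auto intro: negligible_subset[OF negligible_sing[of "0 :: real"]])
  then have "f absolutely_integrable_on {0<..}"
    by (intro nonnegative_absolutely_integrable_1) (auto simp: f_def has_integral_integrable)
  moreover have "range exp = {0 :: real <..}"
    by (auto simp: image_iff) (metis exp_ln)
  ultimately have "f absolutely_integrable_on range exp \<and> integral (range exp) f = Gamma p"
    using f by (simp add: integral_unique)
  then have "(\<lambda>v. \<bar>exp v\<bar> * f (exp v)) absolutely_integrable_on UNIV \<and>
      integral UNIV (\<lambda>v. \<bar>exp v\<bar> * f (exp v)) = Gamma p"
    by (subst has_absolute_integral_change_of_variables_1'[where f = f and g = exp]) (auto intro!: derivative_eq_intros simp: inj_on_def)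
  moreover have "\<bar>exp v\<bar> * f (exp v) = exp (p * v - exp v)" for v :: real
    by (simp add: f_def powr_def exp_diff exp_add flip: exp_add) (simp add: algebra_simps)
  ultimately have *: "(\<lambda>v. exp (p * v - exp v)) absolutely_integrable_on UNIV"
      "integral UNIV (\<lambda>v. exp (p * v - exp v)) = Gamma p"
    by simp_all
  have "integrable lborel (\<lambda>v. exp (p * v - exp v))"
    using *(1) by (simp add: set_integrable_def integrable_completion)
  moreover have "(LINT v|lborel. exp (p * v - exp v)) = Gamma p"
    using set_lebesgue_integral_eq_integral(2)[OF *(1)] *(2)
    by (simp add: set_lebesgue_integral_def integral_completion)
  ultimately have "has_bochner_integral lborel (\<lambda>v. exp (p * v - exp v)) (Gamma p)"
    by (simp add: has_bochner_integral_iff)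
  then have "has_bochner_integral lborel (\<lambda>v. exp (p * (ln c + 1 * v) - exp (ln c + 1 * v))) (Gamma p /\<^sub>R \<bar>1\<bar>)"
    by (subst lborel_has_bochner_integral_real_affine_iff[of 1 _ _ "ln c", symmetric]) simp_all
  then have "has_bochner_integral lborel (\<lambda>v. c powr (- p) * exp (p * (ln c + v) - exp (ln c + v))) (c powr (- p) * Gamma p)"
    by (intro has_bochner_integral_mult_right) simp
  moreover have "c powr (- p) * exp (p * (ln c + v) - exp (ln c + v)) = exp (p * v - c * exp v)" for v
    using assms(2) by (simp add: powr_def exp_add exp_diff exp_minus distrib_left)
  ultimately show ?thesis
    by (simp add: mult.commute)
qed

section \<open>The Matern kernel as a mixture of Gaussians\<close>

text \<open>
The average of the Gaussians $\exp(-\alpha \|z\|^2 / u)$ over a Gamma distributed variance parameter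
$u = e^v$ with shape $\nu$, normalised to be $1$ at the origin.
\<close>

definition matern_mix :: "real \<Rightarrow> real \<Rightarrow> real ^ 'd \<Rightarrow> real" where
  "matern_mix \<nu> \<alpha> z = (LINT v|lborel. exp (\<nu> * v - exp v) * exp (- (\<alpha> * (norm z)\<^sup>2 * exp (- v)))) / Gamma \<nu>"

lemma integral_even_part:
  fixes f :: "real \<Rightarrow> real"
  assumes "integrable lborel f"
  shows "(LINT t|lborel. f t) = (LINT t:{0..}|lborel. f t + f (- t))"
proof -
  have [measurable]: "f \<in> borel_measurable borel"
    using borel_measurable_integrable[OF assms] by simp
  have f': "integrable lborel (\<lambda>t. f (0 + (- 1) * t))"
    using assms by (rule lborel_integrable_real_affine) simp
  have pos: "integrable lborel (\<lambda>t. indicator {0..} t * f t)"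
    using integrable_mult_indicator[OF _ assms, of "{0..}"] by simp
  have neg: "integrable lborel (\<lambda>t. indicator {..<0} t * f t)"
    using integrable_mult_indicator[OF _ assms, of "{..<0}"] by simp
  have neg': "integrable lborel (\<lambda>t. indicator {0..} t * f (- t))"
    using integrable_mult_indicator[OF _ f', of "{0..}"] by simp
  have "(LINT t|lborel. f t) = (LINT t|lborel. indicator {0..} t * f t + indicator {..<0} t * f t)"
    by (rule Bochner_Integration.integral_cong) (auto split: split_indicator)
  also have "\<dots> = (LINT t|lborel. indicator {0..} t * f t) + (LINT t|lborel. indicator {..<0} t * f t)"
    by (rule Bochner_Integration.integral_add[OF pos neg])
  also have "(LINT t|lborel. indicator {..<0} t * f t) = (LINT t|lborel. indicator {..<0} (- t) * f (- t))"
    by (subst lborel_integral_real_affine[of "- 1" _ 0]) simp_all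
  also have "\<dots> = (LINT t|lborel. indicator {0..} t * f (- t))"
  proof (rule integral_cong_AE)
    show "AE t in lborel. indicat_real {..<0} (- t) * f (- t) = indicator {0..} t * f (- t)"
      using AE_lborel_singleton[of "0 :: real"] by eventually_elim (auto split: split_indicator)
  qed measurable
  also have "(LINT t|lborel. indicator {0..} t * f t) + (LINT t|lborel. indicator {0..} t * f (- t))
      = (LINT t:{0..}|lborel. f t + f (- t))"
    unfolding set_lebesgue_integral_def
    by (subst Bochner_Integration.integral_add[OF pos neg', symmetric]) (simp add: distrib_left)
  finally show ?thesis .
qed

lemma gauss_mixture_integrable:
  fixes \<nu> a :: real
  assumes "0 < \<nu>" "0 \<le> a"
  shows "integrable lborel (\<lambda>v. exp (\<nu> * v - exp v) * exp (- (a * exp (- v))))"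
proof (rule Bochner_Integration.integrable_bound)
  show "integrable lborel (\<lambda>v. exp (\<nu> * v - exp v))"
    using integrable.intros[OF gamma_integral_exp[OF assms(1), of 1]] by simp
  show "AE v in lborel. norm (exp (\<nu> * v - exp v) * exp (- (a * exp (- v)))) \<le> norm (exp (\<nu> * v - exp v))"
    using assms(2) by (intro AE_I2) (simp add: abs_mult mult_le_cancel_left1)
qed measurable

text \<open>
The substitution $e^v = \frac{w}{2} e^t$ turns $e^v + \frac{w^2}{4} e^{-v}$ into $w \cosh t$, and
folding the line at $t = 0$ turns $e^{\nu t}$ into $2 \cosh(\nu t)$ on the half-line.
\<close>

lemma bessel_K_eq_gauss_mixture:
  assumes "0 < \<nu>" "0 < w"
  shows "bessel_K \<nu> w = (1/2) * (w / 2) powr (- \<nu>) *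
    (LINT v|lborel. exp (\<nu> * v - exp v) * exp (- (w\<^sup>2 / 4 * exp (- v))))"
proof -
  define f where "f v = exp (\<nu> * v - exp v) * exp (- (w\<^sup>2 / 4 * exp (- v)))" for v
  define g where "g t = exp (\<nu> * t) * exp (- (w * cosh t))" for t
  have f: "integrable lborel f"
    unfolding f_def using assms by (intro gauss_mixture_integrable) simp_all
  have shift: "f (ln (w / 2) + 1 * t) = (w / 2) powr \<nu> * g t" for t
  proof -
    have e: "exp (ln (w / 2) + t) = w / 2 * exp t" "exp (- (ln (w / 2) + t)) = exp (- t) * (2 / w)"
      using assms(2) by (simp_all add: exp_add exp_diff exp_minus field_simps)
    have "f (ln (w / 2) + 1 * t)
        = exp (\<nu> * (ln (w / 2) + t) - w / 2 * exp t + - (w\<^sup>2 / 4 * (exp (- t) * (2 / w))))"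
      unfolding f_def exp_add[symmetric] mult_1 e ..
    also have "\<nu> * (ln (w / 2) + t) - w / 2 * exp t + - (w\<^sup>2 / 4 * (exp (- t) * (2 / w)))
        = \<nu> * ln (w / 2) + (\<nu> * t + - (w * cosh t))"
      using assms(2) by (simp add: cosh_def field_simps power2_eq_square)
    also have "exp \<dots> = exp (\<nu> * ln (w / 2)) * (exp (\<nu> * t) * exp (- (w * cosh t)))"
      by (simp only: exp_add)
    finally show ?thesis
      using assms(2) by (simp add: g_def powr_def)
  qed
  have w: "(w / 2) powr \<nu> > 0" using assms(2) by simp
  have "integrable lborel (\<lambda>t. f (ln (w / 2) + 1 * t))"
    by (rule lborel_integrable_real_affine[OF f]) simp
  then have g: "integrable lborel g"
    unfolding shift using w by (simp add: integrable_mult_right_iff)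
  have g_even: "g t + g (- t) = 2 * (exp (- w * cosh t) * cosh (\<nu> * t))" for t
  proof -
    have "g t + g (- t) = (exp (\<nu> * t) + exp (- (\<nu> * t))) * exp (- (w * cosh t))"
      by (simp add: g_def distrib_right)
    then show ?thesis by (simp add: cosh_def[of "\<nu> * t"])
  qed
  have "(LINT v|lborel. f v) = (LINT t|lborel. f (ln (w / 2) + 1 * t))"
    by (subst lborel_integral_real_affine[of 1 _ "ln (w / 2)"]) simp_all
  also have "\<dots> = (w / 2) powr \<nu> * (LINT t|lborel. g t)"
    unfolding shift by simp
  also have "(LINT t|lborel. g t) = (LINT t:{0..}|lborel. 2 * (exp (- w * cosh t) * cosh (\<nu> * t)))"
    unfolding integral_even_part[OF g]
    by (rule set_lebesgue_integral_cong) (simp_all add: g_even)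
  also have "\<dots> = 2 * bessel_K \<nu> w"
    unfolding bessel_K_def by (rule set_integral_mult_right)
  finally have "(LINT v|lborel. f v) = (w / 2) powr \<nu> * (2 * bessel_K \<nu> w)" .
  then show ?thesis
    using assms(2) unfolding f_def powr_minus by (simp add: field_simps)
qed

text \<open>
The Matern kernel as a scale mixture of Gaussians. At $x = y$ the mixture is the Gamma integral
itself, which is why the value $\sigma^2$ on the diagonal fits.
\<close>

lemma matern_eq_matern_mix:
  assumes "0 < \<nu>" "0 < l"
  shows "matern \<nu> \<sigma> l x y = \<sigma>\<^sup>2 * matern_mix \<nu> (\<nu> / (2 * l\<^sup>2)) (x - y)"
proof (cases "x = y")
  case True
  have "(LINT v|lborel. exp (\<nu> * v - exp v)) = Gamma \<nu>"
    using has_bochner_integral_integral_eq[OF gamma_integral_exp[OF assms(1), of 1]] by simp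
  then show ?thesis
    using True Gamma_real_pos[OF assms(1)] by (simp add: matern_def matern_mix_def)
next
  case False
  define w where "w = sqrt (2 * \<nu>) * norm (x - y) / l"
  have w: "0 < w" using False assms by (simp add: w_def)
  have sq: "\<nu> / (2 * l\<^sup>2) * (norm (x - y))\<^sup>2 = w\<^sup>2 / 4"
    using assms by (simp add: w_def power_mult_distrib power_divide)
  have "2 powr (1 - \<nu>) * w powr \<nu> * ((1/2) * (w / 2) powr (- \<nu>)) = 1"
    using w by (simp add: powr_diff powr_minus powr_divide field_simps)
  moreover have rearrange: "a / b * c * (d * j) = j / b" if "a * c * d = 1" for a b c d j :: real
    using arg_cong[OF that, of "\<lambda>u. u * j / b"] by (simp add: mult_ac)
  ultimately have "(2 powr (1 - \<nu>) / Gamma \<nu>) * w powr \<nu> * bessel_K \<nu> w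
      = (LINT v|lborel. exp (\<nu> * v - exp v) * exp (- (w\<^sup>2 / 4 * exp (- v)))) / Gamma \<nu>"
    unfolding bessel_K_eq_gauss_mixture[OF assms(1) w] by (intro rearrange)
  moreover have "matern \<nu> \<sigma> l x y = \<sigma>\<^sup>2 * ((2 powr (1 - \<nu>) / Gamma \<nu>) * w powr \<nu> * bessel_K \<nu> w)"
    using False by (simp only: matern_def w_def if_False mult.assoc)
  ultimately show ?thesis
    by (simp only: matern_mix_def sq)
qed

section \<open>The spectral density\<close>

abbreviation freq_measure :: "('d :: finite \<Rightarrow> real) measure" where
  "freq_measure \<equiv> Pi\<^sub>M UNIV (\<lambda>_. lborel)"

text \<open>
The density of the multivariate Student distribution: the average over $u$ of the Gaussian densities
with variance $2\alpha/u$ in each coordinate. Frequencies are functions on the index type, so that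
the product measure is literally a product of one-dimensional ones.
\<close>

definition matern_spectral_density :: "real \<Rightarrow> real \<Rightarrow> ('d :: finite \<Rightarrow> real) \<Rightarrow> real" where
  "matern_spectral_density \<nu> \<alpha> s =
     Gamma (\<nu> + real CARD('d) / 2) / Gamma \<nu> * (4 * pi * \<alpha>) powr (- (real CARD('d) / 2))
     * (1 + (\<Sum>j\<in>UNIV. (s j)\<^sup>2) / (4 * \<alpha>)) powr (- (\<nu> + real CARD('d) / 2))"

lemma matern_spectral_density_pos:
  assumes "0 < \<nu>" "0 < \<alpha>"
  shows "0 < matern_spectral_density \<nu> \<alpha> (s :: 'd :: finite \<Rightarrow> real)"
proof -
  have "0 < Gamma (\<nu> + real CARD('d) / 2)"
    using assms by (intro Gamma_real_pos) (simp add: add_pos_nonneg)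
  moreover have "0 < 1 + (\<Sum>j\<in>UNIV. (s j)\<^sup>2) / (4 * \<alpha>)"
    using assms by (intro add_pos_nonneg divide_nonneg_pos sum_nonneg) simp_all
  ultimately show ?thesis
    using assms Gamma_real_pos[OF assms(1)] unfolding matern_spectral_density_def
    by (intro mult_pos_pos divide_pos_pos) simp_all
qed

lemma prod_normal_density:
  assumes "0 < \<alpha>"
  shows "(\<Prod>j\<in>(UNIV :: 'd :: finite set). normal_density 0 (sqrt (2 * \<alpha> * exp (- v))) (s j))
    = (4 * pi * \<alpha>) powr (- (real CARD('d) / 2)) * exp (real CARD('d) / 2 * v - (\<Sum>j\<in>UNIV. (s j)\<^sup>2) / (4 * \<alpha>) * exp v)"
proof -
  have d: "normal_density 0 (sqrt (2 * \<alpha> * exp (- v))) x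
      = exp (- (1/2) * (ln (4 * pi * \<alpha>) - v)) * exp (- x\<^sup>2 / (4 * \<alpha>) * exp v)" for x
  proof -
    have "1 / sqrt (4 * pi * \<alpha> * exp (- v)) = (4 * pi * \<alpha> * exp (- v)) powr (- (1/2))"
      using assms by (simp add: powr_half_sqrt powr_minus_divide)
    also have "\<dots> = exp (- (1/2) * (ln (4 * pi * \<alpha>) - v))"
      using assms by (simp add: powr_def ln_mult)
    finally have "1 / sqrt (4 * pi * \<alpha> * exp (- v)) = exp (- (1/2) * (ln (4 * pi * \<alpha>) - v))" .
    moreover have "- x\<^sup>2 / (4 * \<alpha> * exp (- v)) = - x\<^sup>2 / (4 * \<alpha>) * exp v"
      using assms by (simp add: exp_minus field_simps)
    ultimately show ?thesis
      using assms by (simp add: normal_density_def mult.assoc mult.left_commute[of pi])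
  qed
  have "(\<Prod>j\<in>(UNIV :: 'd set). normal_density 0 (sqrt (2 * \<alpha> * exp (- v))) (s j))
      = exp (real CARD('d) * (- (1/2) * (ln (4 * pi * \<alpha>) - v))) * exp (\<Sum>j\<in>UNIV. - (s j)\<^sup>2 / (4 * \<alpha>) * exp v)"
    by (simp only: d prod.distrib prod_constant exp_of_nat_mult exp_sum[OF finite])
  also have "(\<Sum>j\<in>UNIV. - (s j)\<^sup>2 / (4 * \<alpha>) * exp v) = - ((\<Sum>j\<in>UNIV. (s j)\<^sup>2) / (4 * \<alpha>) * exp v)"
    by (simp add: sum_negf sum_distrib_right sum_divide_distrib)
  finally have "(\<Prod>j\<in>(UNIV :: 'd set). normal_density 0 (sqrt (2 * \<alpha> * exp (- v))) (s j))
      = exp (real CARD('d) * (- (1/2) * (ln (4 * pi * \<alpha>) - v))) * exp (- ((\<Sum>j\<in>UNIV. (s j)\<^sup>2) / (4 * \<alpha>) * exp v))" .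
  moreover have "(4 * pi * \<alpha>) powr (- (real CARD('d) / 2)) = exp (- (real CARD('d) / 2) * ln (4 * pi * \<alpha>))"
    using assms by (simp add: powr_def)
  ultimately show ?thesis
    by (simp only: flip: exp_add) (simp add: field_simps)
qed

lemma gaussian_fourier:
  fixes z :: "real ^ 'd"
  assumes "0 < \<alpha>"
  defines "h \<equiv> \<lambda>v. normal_density 0 (sqrt (2 * \<alpha> * exp (- v)))"
  shows "integrable freq_measure (\<lambda>s. (\<Prod>j\<in>(UNIV :: 'd set). h v (s j)) * cos (\<Sum>j\<in>UNIV. s j * vec_nth z j))"
    and "(LINT s|freq_measure. (\<Prod>j\<in>(UNIV :: 'd set). h v (s j)) * cos (\<Sum>j\<in>UNIV. s j * vec_nth z j))
      = exp (- (\<alpha> * (norm z)\<^sup>2 * exp (- v)))"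
proof -
  have h: "integrable lborel (h v)"
    unfolding h_def using assms by (intro integrable_normal_density) simp
  have even: "h v (- s) = h v s" for s
    by (simp add: h_def normal_density_def)
  show "integrable freq_measure (\<lambda>s. (\<Prod>j\<in>(UNIV :: 'd set). h v (s j)) * cos (\<Sum>j\<in>UNIV. s j * vec_nth z j))"
    by (rule fourier_cos_tensor(1)[OF h even])
  have "(LINT s|lborel. h v s * cos (s * y)) = exp (- (\<alpha> * exp (- v) * y\<^sup>2))" for y
    unfolding h_def using assms by (subst normal_density_fourier) simp_all
  then have "(LINT s|freq_measure. (\<Prod>j\<in>(UNIV :: 'd set). h v (s j)) * cos (\<Sum>j\<in>UNIV. s j * vec_nth z j))
      = (\<Prod>j\<in>UNIV. exp (- (\<alpha> * exp (- v) * (vec_nth z j)\<^sup>2)))"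
    by (simp add: fourier_cos_tensor(2)[OF h even])
  also have "\<dots> = exp (- (\<alpha> * exp (- v) * (\<Sum>j\<in>UNIV. (vec_nth z j)\<^sup>2)))"
    by (simp add: sum_negf sum_distrib_left flip: exp_sum)
  finally show "(LINT s|freq_measure. (\<Prod>j\<in>(UNIV :: 'd set). h v (s j)) * cos (\<Sum>j\<in>UNIV. s j * vec_nth z j))
      = exp (- (\<alpha> * (norm z)\<^sup>2 * exp (- v)))"
    by (simp add: sum_square_eq_norm mult_ac)
qed

text \<open>
Each Gaussian in the mixture is the Fourier transform of a Gaussian density. By Fubini the mixing
over the variance may be carried out on the densities, where it is a Gamma integral with shape
$\nu + d/2$.
\<close>

lemma matern_mix_fourier:
  fixes z :: "real ^ 'd"
  assumes "0 < \<nu>" "0 < \<alpha>"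
  shows "integrable freq_measure (\<lambda>s. matern_spectral_density \<nu> \<alpha> s * cos (\<Sum>j\<in>UNIV. s j * vec_nth z j))"
    and "(LINT s|freq_measure. matern_spectral_density \<nu> \<alpha> s * cos (\<Sum>j\<in>UNIV. s j * vec_nth z j))
      = matern_mix \<nu> \<alpha> z"
proof -
  interpret product_sigma_finite "\<lambda>_ :: 'd. lborel :: real measure" ..
  interpret finite_product_sigma_finite "\<lambda>_ :: 'd. lborel :: real measure" UNIV
    by standard simp
  interpret P: pair_sigma_finite lborel "freq_measure :: ('d \<Rightarrow> real) measure" ..
  \<comment> \<open>The integrand without the cosine: it is nonnegative, with iterated integral
    $\Gamma(\nu)$, and dominates the oscillating one in the use of Fubini.\<close>
  define G where "G v s = exp (\<nu> * v - exp v)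
      * (\<Prod>j\<in>(UNIV :: 'd set). normal_density 0 (sqrt (2 * \<alpha> * exp (- v))) (s j))" for v s
  define F where "F v s = G v s * cos (\<Sum>j\<in>UNIV. s j * vec_nth z j)" for v s
  have G_nonneg: "0 \<le> G v s" for v s
    by (simp add: G_def prod_nonneg)
  have G_meas [measurable]: "(\<lambda>(v, s). G v s) \<in> borel_measurable (lborel \<Otimes>\<^sub>M freq_measure)"
    unfolding G_def normal_density_def by measurable
  have G_int: "integrable freq_measure (G v)" "(LINT s|freq_measure. G v s) = exp (\<nu> * v - exp v)" for v
    using gaussian_fourier[OF assms(2), of v "0 :: real ^ 'd"] by (simp_all add: G_def[abs_def])
  have int: "integrable (lborel \<Otimes>\<^sub>M freq_measure) (\<lambda>(v, s). F v s)"
  proof (rule Bochner_Integration.integrable_bound)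
    show "integrable (lborel \<Otimes>\<^sub>M freq_measure) (\<lambda>(v, s). G v s)"
      using integrable.intros[OF gamma_integral_exp[OF assms(1), of 1]]
      by (intro P.Fubini_integrable) (simp_all add: G_int G_nonneg)
    show "AE p in lborel \<Otimes>\<^sub>M freq_measure. norm (case p of (v, s) \<Rightarrow> F v s) \<le> norm (case p of (v, s) \<Rightarrow> G v s)"
      by (intro AE_I2) (auto simp: F_def abs_mult intro!: mult_left_le)
  qed (unfold F_def, measurable)
  have W: "(LINT v|lborel. G v s) = Gamma \<nu> * matern_spectral_density \<nu> \<alpha> s" for s
  proof -
    let ?p = "\<nu> + real CARD('d) / 2" and ?q = "(\<Sum>j\<in>UNIV. (s j)\<^sup>2) / (4 * \<alpha>)"
    have "0 < 1 + ?q"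
      using assms by (intro add_pos_nonneg divide_nonneg_pos sum_nonneg) simp_all
    moreover have "0 < ?p" using assms by (simp add: add_pos_nonneg)
    ultimately have *: "(LINT v|lborel. exp (?p * v - (1 + ?q) * exp v)) = Gamma ?p * (1 + ?q) powr (- ?p)"
      by (intro has_bochner_integral_integral_eq gamma_integral_exp)
    have "G v s = (4 * pi * \<alpha>) powr (- (real CARD('d) / 2)) * exp (?p * v - (1 + ?q) * exp v)" for v
      unfolding G_def prod_normal_density[OF assms(2)]
      by (simp add: mult.left_commute flip: exp_add) (simp add: algebra_simps)
    then show ?thesis
      using Gamma_real_pos[OF assms(1)] by (simp add: * matern_spectral_density_def)
  qed
  have F_W: "(LINT v|lborel. F v s) = Gamma \<nu> * (matern_spectral_density \<nu> \<alpha> s * cos (\<Sum>j\<in>UNIV. s j * vec_nth z j))" for s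
    by (simp add: F_def W)
  have "integrable freq_measure (\<lambda>s. LINT v|lborel. F v s)"
    by (rule P.integrable_snd[OF int])
  then show "integrable freq_measure (\<lambda>s. matern_spectral_density \<nu> \<alpha> s * cos (\<Sum>j\<in>UNIV. s j * vec_nth z j))"
    unfolding F_W using Gamma_real_pos[OF assms(1)] by (simp add: integrable_mult_right_iff)
  have "(LINT s|freq_measure. LINT v|lborel. F v s) = (LINT v|lborel. LINT s|freq_measure. F v s)"
    by (rule P.Fubini_integral[OF int])
  also have "\<dots> = (LINT v|lborel. exp (\<nu> * v - exp v) * exp (- (\<alpha> * (norm z)\<^sup>2 * exp (- v))))"
    by (simp only: F_def G_def mult.assoc[of "exp (\<nu> * _ - exp _)"] integral_mult_right_zero
        gaussian_fourier(2)[OF assms(2)])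
  finally show "(LINT s|freq_measure. matern_spectral_density \<nu> \<alpha> s * cos (\<Sum>j\<in>UNIV. s j * vec_nth z j))
      = matern_mix \<nu> \<alpha> z"
    unfolding F_W using Gamma_real_pos[OF assms(1)] by (simp add: matern_mix_def field_simps)
qed

section \<open>A lower bound for quadratic forms at an isolated point\<close>

text \<open>
The test function used below has finite norm in the native space of the kernel as soon as its
transform decays fast enough; the exponent $m$ of the cardinal sine buys this decay.
\<close>

lemma integrable_weighted_sinc_power:
  assumes "p + 1 \<le> real m"
  shows "integrable lborel (\<lambda>s. (sinc s ^ m)\<^sup>2 * (1 + s\<^sup>2) powr p)"
proof (rule Bochner_Integration.integrable_bound)
  show "integrable lborel (\<lambda>s :: real. 2 ^ m * inverse (1 + s\<^sup>2))"
    using integrable_inverse_1_plus_square_UNIV by simp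
  have "norm ((sinc s ^ m)\<^sup>2 * (1 + s\<^sup>2) powr p) \<le> norm (2 ^ m * inverse (1 + s\<^sup>2))" for s
  proof -
    have pos: "1 \<le> 1 + s\<^sup>2" "0 < 1 + s\<^sup>2" by (simp_all add: add_pos_nonneg)
    have "(sinc s ^ m)\<^sup>2 = ((sinc s)\<^sup>2) ^ m"
      by (simp only: power_mult[symmetric] mult.commute)
    also have "\<dots> \<le> (2 * inverse (1 + s\<^sup>2)) ^ m"
      by (rule power_mono[OF sinc_square_le zero_le_power2])
    also have "\<dots> = 2 ^ m * (1 + s\<^sup>2) powr (- real m)"
      using pos by (simp add: power_mult_distrib powr_minus powr_realpow power_inverse)
    finally have "(sinc s ^ m)\<^sup>2 * (1 + s\<^sup>2) powr p \<le> 2 ^ m * (1 + s\<^sup>2) powr (- real m) * (1 + s\<^sup>2) powr p"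
      by (rule mult_right_mono) simp
    also have "\<dots> = 2 ^ m * (1 + s\<^sup>2) powr (p - real m)"
      by (simp add: mult.assoc flip: powr_add)
    also have "\<dots> \<le> 2 ^ m * (1 + s\<^sup>2) powr (- 1)"
      using assms pos by (intro mult_left_mono powr_mono) simp_all
    also have "\<dots> = 2 ^ m * inverse (1 + s\<^sup>2)"
      using pos by (simp add: powr_minus)
    finally have "(sinc s ^ m)\<^sup>2 * (1 + s\<^sup>2) powr p \<le> 2 ^ m * inverse (1 + s\<^sup>2)" .
    moreover have "0 \<le> (sinc s ^ m)\<^sup>2 * (1 + s\<^sup>2) powr p"
      by (intro mult_nonneg_nonneg zero_le_power2 powr_ge_zero)
    ultimately show ?thesis
      by (metis abs_of_nonneg order_trans real_norm_def)
  qed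
  then show "AE s in lborel. norm ((sinc s ^ m)\<^sup>2 * (1 + s\<^sup>2) powr p) \<le> norm (2 ^ m * inverse (1 + s\<^sup>2))"
    by blast
qed measurable

text \<open>
The density decays like $|s|^{-2\nu-d}$. The bound is written with a product over the coordinates
because the integrals that it feeds must factorise, and with an explicit power of $\alpha$ because
$\alpha$ carries the length scale: the factor $\alpha^{\nu}$ is the source of the rate
$h^{2\nu}$ in the theorem.
\<close>

lemma matern_spectral_density_lower:
  assumes "0 < \<nu>" "0 < \<alpha>\<^sub>0"
  obtains D where "0 < D" "\<And>\<alpha> (s :: 'd :: finite \<Rightarrow> real). 0 < \<alpha> \<Longrightarrow> \<alpha> \<le> \<alpha>\<^sub>0 \<Longrightarrow>
    1 \<le> D * \<alpha> powr (- \<nu>) * matern_spectral_density \<nu> \<alpha> s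
         * (\<Prod>j\<in>UNIV. (1 + (s j)\<^sup>2) powr (\<nu> + real CARD('d) / 2))"
proof
  define p where "p = \<nu> + real CARD('d) / 2"
  have p: "0 < p" using assms by (simp add: p_def add_pos_nonneg)
  define D where "D = Gamma \<nu> / Gamma p * (4 * pi) powr (real CARD('d) / 2) * (\<alpha>\<^sub>0 + 1) powr p"
  have G: "0 < Gamma \<nu>" "0 < Gamma p"
    using assms p by (auto intro: Gamma_real_pos)
  show "0 < D"
    using assms G by (simp add: D_def)
  fix \<alpha> and s :: "'d \<Rightarrow> real"
  assume \<alpha>: "0 < \<alpha>" "\<alpha> \<le> \<alpha>\<^sub>0"
  define S where "S = (\<Sum>j\<in>UNIV. (s j)\<^sup>2)"
  define P where "P = (\<Prod>j\<in>UNIV. 1 + (s j)\<^sup>2)"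
  have S: "0 \<le> S" by (simp add: S_def sum_nonneg)
  have P: "1 \<le> P"
    unfolding P_def by (rule prod_ge_1) simp
  have "S \<le> P"
    unfolding S_def P_def by (rule sum_le_prod) simp
  have "\<alpha> + S / 4 \<le> \<alpha>\<^sub>0 * 1 + P"
    using \<alpha> S \<open>S \<le> P\<close> by linarith
  also have "\<dots> \<le> \<alpha>\<^sub>0 * P + P"
    using P assms by (intro add_right_mono mult_left_mono) simp_all
  also have "\<dots> = (\<alpha>\<^sub>0 + 1) * P"
    by (simp add: distrib_right)
  finally have le: "\<alpha> + S / 4 \<le> (\<alpha>\<^sub>0 + 1) * P" .
  have pos: "0 < \<alpha> + S / 4" using \<alpha> S by simp
  have "0 < P" using P by linarith
  have "\<alpha> * (1 + S / (4 * \<alpha>)) = \<alpha> + S / 4"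
    using \<alpha> by (simp add: field_simps)
  moreover have "0 \<le> 1 + S / (4 * \<alpha>)" using \<alpha> S by simp
  ultimately have scale: "\<alpha> powr (- p) * (1 + S / (4 * \<alpha>)) powr (- p) = (\<alpha> + S / 4) powr (- p)"
    using \<alpha> by (metis less_imp_le powr_mult)
  have "1 = (\<alpha> + S / 4) powr p * (\<alpha> + S / 4) powr (- p)"
    using pos by (simp add: powr_minus)
  also have "\<dots> \<le> ((\<alpha>\<^sub>0 + 1) * P) powr p * (\<alpha> + S / 4) powr (- p)"
    using le pos p by (intro mult_right_mono powr_mono2) simp_all
  also have "((\<alpha>\<^sub>0 + 1) * P) powr p = (\<alpha>\<^sub>0 + 1) powr p * P powr p"
    using assms \<open>0 < P\<close> by (simp add: powr_mult)
  also have "(\<alpha>\<^sub>0 + 1) powr p * P powr p * (\<alpha> + S / 4) powr (- p)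
      = D * \<alpha> powr (- \<nu>) * matern_spectral_density \<nu> \<alpha> s * P powr p"
  proof -
    have "\<alpha> powr (- \<nu>) * \<alpha> powr (- (real CARD('d) / 2)) = \<alpha> powr (- p)"
      by (simp add: p_def flip: powr_add)
    then have "D * \<alpha> powr (- \<nu>) * matern_spectral_density \<nu> \<alpha> s
       = (Gamma \<nu> / Gamma p * (Gamma p / Gamma \<nu>))
         * ((4 * pi) powr (real CARD('d) / 2) * (4 * pi) powr (- (real CARD('d) / 2)))
         * (\<alpha>\<^sub>0 + 1) powr p * (\<alpha> powr (- p) * (1 + S / (4 * \<alpha>)) powr (- p))"
      using \<alpha> by (simp add: D_def matern_spectral_density_def powr_mult flip: p_def S_def)
    also have "\<dots> = (\<alpha>\<^sub>0 + 1) powr p * (\<alpha> + S / 4) powr (- p)"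
      unfolding scale using G by (simp add: powr_minus)
    finally show ?thesis by simp
  qed
  also have "P powr p = (\<Prod>j\<in>UNIV. (1 + (s j)\<^sup>2) powr p)"
    unfolding P_def by (rule prod_powr_distrib)
  finally show "1 \<le> D * \<alpha> powr (- \<nu>) * matern_spectral_density \<nu> \<alpha> s
         * (\<Prod>j\<in>UNIV. (1 + (s j)\<^sup>2) powr (\<nu> + real CARD('d) / 2))"
    by (simp only: p_def)
qed

text \<open>
The right-hand side is the squared modulus of $\sum_j a_j e^{i (u_j - c)}$ ($i$ the imaginary unit),
which does not depend on $c$; the left-hand side is the square of its real part.
\<close>

lemma cos_quadratic_form:
  fixes a u :: "'i \<Rightarrow> real"
  shows "(\<Sum>i\<in>I. a i * cos (u i - c))\<^sup>2 \<le> (\<Sum>i\<in>I. \<Sum>j\<in>I. a i * a j * cos (u i - u j))"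
proof -
  have "(\<Sum>i\<in>I. \<Sum>j\<in>I. a i * a j * cos (u i - u j))
      = (\<Sum>i\<in>I. a i * cos (u i - c))\<^sup>2 + (\<Sum>i\<in>I. a i * sin (u i - c))\<^sup>2"
  proof -
    have "cos (u i - u j) = cos (u i - c) * cos (u j - c) + sin (u i - c) * sin (u j - c)" for i j
      using cos_diff[of "u i - c" "u j - c"] by simp
    then show ?thesis
      by (simp add: power2_eq_square sum_product distrib_left mult_ac flip: sum.distrib)
  qed
  then show ?thesis by simp
qed

definition quadratic_form :: "('p \<Rightarrow> 'p \<Rightarrow> real) \<Rightarrow> 'i set \<Rightarrow> ('i \<Rightarrow> 'p) \<Rightarrow> ('i \<Rightarrow> real) \<Rightarrow> real" where
  "quadratic_form k I y a = (\<Sum>i\<in>I. \<Sum>j\<in>I. a i * a j * k (y i) (y j))"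

text \<open>
Separation of one distinguished point only: the lower bounds proved from it are insensitive to
clusters among the other points.
\<close>

definition isolated_at :: "real \<Rightarrow> 'i set \<Rightarrow> ('i \<Rightarrow> 'p :: real_normed_vector) \<Rightarrow> 'i \<Rightarrow> bool" where
  "isolated_at \<delta> I y i\<^sub>0 \<longleftrightarrow> finite I \<and> i\<^sub>0 \<in> I \<and> (\<forall>i\<in>I. i \<noteq> i\<^sub>0 \<longrightarrow> \<delta> \<le> norm (y i - y i\<^sub>0))"

lemma ex_large_coordinate:
  fixes w :: "real ^ 'd"
  assumes "r * real CARD('d) \<le> norm w"
  shows "\<exists>j. r \<le> \<bar>vec_nth w j\<bar>"
proof (rule ccontr)
  assume "\<nexists>j. r \<le> \<bar>vec_nth w j\<bar>"
  then have "(\<Sum>j\<in>UNIV. \<bar>vec_nth w j\<bar>) < (\<Sum>j\<in>(UNIV :: 'd set). r)"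
    by (intro sum_strict_mono) (simp_all add: not_le)
  then show False
    using assms norm_le_l1_cart[of w] by (simp add: mult.commute)
qed

text \<open>
The heart of the matter, a duality argument. Let $\Phi$ be a tensor power of the cardinal sine. Its
transform vanishes at $z_i - z_{i_0}$ for all $i \ne i_0$, so that it filters $a_{i_0}$ out of
$C(s) = \sum_i a_i \cos(s \cdot (z_i - z_{i_0}))$: $\int \Phi C = a_{i_0} b$ with $b > 0$. On the
other hand the quadratic form is at least $\int W C^2$, where $W$ is the spectral density. The
Cauchy-Schwarz inequality $(\int \Phi C)^2 \le \int \Phi^2/W \cdot \int W C^2$ gives the claim, since
$\int \Phi^2 / W$ is at most a constant times $\alpha^{-\nu}$. Since $\Phi$ is
chosen in terms of $\nu$ and the dimension alone, the constants are uniform in the number and position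
of the points.
\<close>

lemma matern_mix_quadratic_form_lower:
  fixes \<nu> \<alpha>\<^sub>0 :: real
  assumes "0 < \<nu>" "0 < \<alpha>\<^sub>0"
  shows "\<exists>R. \<exists>c>0. \<forall>\<alpha> I (z :: 'i \<Rightarrow> real ^ 'd) i\<^sub>0 a.
    0 < \<alpha> \<longrightarrow> \<alpha> \<le> \<alpha>\<^sub>0 \<longrightarrow> isolated_at R I z i\<^sub>0
    \<longrightarrow> c * \<alpha> powr \<nu> * (a i\<^sub>0)\<^sup>2 \<le> quadratic_form (\<lambda>p q. matern_mix \<nu> \<alpha> (p - q)) I z a"
proof -
  define p where "p = \<nu> + real CARD('d) / 2"
  obtain n :: nat where n: "p + 2 \<le> real n"
    using real_arch_simple by blast
  \<comment> \<open>An even exponent makes the transform positive at the origin, and \<open>m \<ge> p + 1\<close>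
    makes the weighted integral of the squared transform finite.\<close>
  define m where "m = 2 * n"
  have "0 < p" using assms by (simp add: p_def add_pos_nonneg)
  with n have m: "2 \<le> m" "even m" "p + 1 \<le> real m" by (simp_all add: m_def)
  define \<phi> where "\<phi> s = sinc s ^ m" for s
  define \<psi> where "\<psi> s = (\<phi> s)\<^sup>2 * (1 + s\<^sup>2) powr p" for s
  have \<phi>: "integrable lborel \<phi>" "\<phi> (- s) = \<phi> s" for s
    unfolding \<phi>_def[abs_def] using integrable_sinc_power[OF m(1)] by simp_all
  have \<psi>: "integrable lborel \<psi>" "\<psi> (- s) = \<psi> s" for s
    using integrable_weighted_sinc_power[OF m(3)] by (simp_all only: \<psi>_def[abs_def] \<phi>_def sinc_neg power2_minus)
  have \<psi>_nonneg: "0 \<le> \<psi> s" for s by (simp add: \<psi>_def)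
  define b where "b = (LINT s|lborel. \<phi> s) ^ CARD('d)"
  define J where "J = (LINT s|lborel. \<psi> s)"
  have b: "0 < b"
    unfolding b_def \<phi>_def by (intro zero_less_power sinc_power_integral_pos m)
  have J: "0 \<le> J"
    unfolding J_def by (rule Bochner_Integration.integral_nonneg) (rule \<psi>_nonneg)
  obtain D where D: "0 < D" and D_bound: "\<And>\<alpha> (s :: 'd \<Rightarrow> real). 0 < \<alpha> \<Longrightarrow> \<alpha> \<le> \<alpha>\<^sub>0 \<Longrightarrow>
      1 \<le> D * \<alpha> powr (- \<nu>) * matern_spectral_density \<nu> \<alpha> s * (\<Prod>j\<in>UNIV. (1 + (s j)\<^sup>2) powr p)"
    using matern_spectral_density_lower[OF assms, where 'd = 'd] unfolding p_def by blast
  \<comment> \<open>\<open>J + 1\<close> is an upper bound for \<open>J\<close> that is visibly positive.\<close>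
  define c where "c = b\<^sup>2 / (D * (J + 1) ^ CARD('d))"
  have "0 < (J + 1) ^ CARD('d)" using J by simp
  then have c: "0 < c" using b D by (simp add: c_def)
  have main: "c * \<alpha> powr \<nu> * (a i\<^sub>0)\<^sup>2 \<le> quadratic_form (\<lambda>p q. matern_mix \<nu> \<alpha> (p - q)) I z a"
    if \<alpha>: "0 < \<alpha>" "\<alpha> \<le> \<alpha>\<^sub>0" and isolated: "isolated_at (real m * real CARD('d)) I z i\<^sub>0"
    for \<alpha> I and z :: "'i \<Rightarrow> real ^ 'd" and a i\<^sub>0
  proof -
    have I: "finite I" "i\<^sub>0 \<in> I"
      and sep: "\<And>i. i \<in> I \<Longrightarrow> i \<noteq> i\<^sub>0 \<Longrightarrow> \<exists>j. real m \<le> \<bar>vec_nth (z i - z i\<^sub>0) j\<bar>"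
      using isolated unfolding isolated_at_def by (blast intro: ex_large_coordinate)+
    define W where "W = (matern_spectral_density \<nu> \<alpha> :: ('d \<Rightarrow> real) \<Rightarrow> real)"
    define \<Phi> where "\<Phi> s = (\<Prod>j\<in>UNIV. \<phi> (s j))" for s :: "'d \<Rightarrow> real"
    define \<Psi> where "\<Psi> s = (\<Prod>j\<in>UNIV. \<psi> (s j))" for s :: "'d \<Rightarrow> real"
    define dot where "dot s w = (\<Sum>j\<in>UNIV. s j * vec_nth w j)" for s :: "'d \<Rightarrow> real" and w :: "real ^ 'd"
    define T where "T s = (\<Sum>i\<in>I. \<Sum>j\<in>I. a i * a j * cos (dot s (z i - z j)))" for s
    define C where "C s = (\<Sum>i\<in>I. a i * cos (dot s (z i - z i\<^sub>0)))" for s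
    define K where "K = D * \<alpha> powr (- \<nu>)"
    define A where "A = K * (J + 1) ^ CARD('d)"
    define \<theta> where "\<theta> = a i\<^sub>0 * b / A"
    define Q where "Q = quadratic_form (\<lambda>p q. matern_mix \<nu> \<alpha> (p - q)) I z a"
    have K: "0 < K" using D \<alpha> by (simp add: K_def)
    then have A: "0 < A" using J by (simp add: A_def)
    have W_pos: "0 < W s" for s
      unfolding W_def by (rule matern_spectral_density_pos[OF assms(1) \<alpha>(1)])
    have dot_diff: "dot s (w - w') = dot s w - dot s w'" for s w w'
      by (simp add: dot_def right_diff_distrib sum_subtractf)
    have \<Phi>_sq: "(\<Phi> s)\<^sup>2 \<le> W s * (K * \<Psi> s)" for s
    proof -
      have "\<Psi> s = (\<Phi> s)\<^sup>2 * (\<Prod>j\<in>UNIV. (1 + (s j)\<^sup>2) powr p)"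
        by (simp add: \<Psi>_def \<Phi>_def \<psi>_def prod.distrib prod_power_distrib)
      then have "W s * (K * \<Psi> s)
          = (\<Phi> s)\<^sup>2 * (D * \<alpha> powr (- \<nu>) * W s * (\<Prod>j\<in>UNIV. (1 + (s j)\<^sup>2) powr p))"
        by (simp add: K_def mult_ac)
      moreover have "(\<Phi> s)\<^sup>2 * 1 \<le> \<dots>"
        unfolding W_def by (intro mult_left_mono D_bound \<alpha>) simp
      ultimately show ?thesis by (simp only: mult_1_right)
    qed
    \<comment> \<open>Cauchy-Schwarz in pointwise form, obtained by expanding a square; the free parameter
      \<open>\<theta>\<close> is the one that optimises the integrated inequality.\<close>
    have pointwise: "2 * \<theta> * (\<Phi> s * C s) - \<theta>\<^sup>2 * K * \<Psi> s \<le> W s * T s" for s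
    proof -
      have "(C s)\<^sup>2 \<le> T s"
        unfolding C_def T_def dot_diff by (rule cos_quadratic_form)
      then have "W s * (W s * (C s)\<^sup>2) \<le> W s * (W s * T s)"
        using W_pos[of s] by simp
      moreover have "0 \<le> (W s * C s - \<theta> * \<Phi> s)\<^sup>2" by simp
      moreover have "\<theta>\<^sup>2 * (\<Phi> s)\<^sup>2 \<le> \<theta>\<^sup>2 * (W s * (K * \<Psi> s))"
        by (rule mult_left_mono[OF \<Phi>_sq]) simp
      ultimately have "W s * (2 * \<theta> * (\<Phi> s * C s) - \<theta>\<^sup>2 * K * \<Psi> s) \<le> W s * (W s * T s)"
        by (simp add: power2_diff power_mult_distrib algebra_simps power2_eq_square)
      then show ?thesis using W_pos[of s] by simp
    qed
    have WT: "integrable freq_measure (\<lambda>s. W s * T s)" "(LINT s|freq_measure. W s * T s) = Q"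
    proof -
      have W_cos: "integrable freq_measure (\<lambda>s. W s * cos (dot s w))"
          "(LINT s|freq_measure. W s * cos (dot s w)) = matern_mix \<nu> \<alpha> w" for w
        unfolding W_def dot_def using matern_mix_fourier[OF assms(1) \<alpha>(1)] by blast+
      have eq: "W s * T s = (\<Sum>i\<in>I. \<Sum>j\<in>I. a i * a j * (W s * cos (dot s (z i - z j))))" for s
        by (simp add: T_def sum_distrib_left mult.left_commute)
      show "integrable freq_measure (\<lambda>s. W s * T s)"
        unfolding eq by (intro Bochner_Integration.integrable_sum integrable_mult_right W_cos)
      show "(LINT s|freq_measure. W s * T s) = Q"
        unfolding eq Q_def quadratic_form_def by (simp add: Bochner_Integration.integral_sum W_cos)
    qed
    have \<Phi>C: "integrable freq_measure (\<lambda>s. \<Phi> s * C s)" "(LINT s|freq_measure. \<Phi> s * C s) = a i\<^sub>0 * b"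
    proof -
      have \<Phi>_cos: "integrable freq_measure (\<lambda>s. \<Phi> s * cos (dot s w))"
          "(LINT s|freq_measure. \<Phi> s * cos (dot s w)) = (\<Prod>j\<in>UNIV. LINT s|lborel. \<phi> s * cos (s * vec_nth w j))" for w
        unfolding \<Phi>_def dot_def using fourier_cos_tensor[OF \<phi>] by blast+
      have eq: "\<Phi> s * C s = (\<Sum>i\<in>I. a i * (\<Phi> s * cos (dot s (z i - z i\<^sub>0))))" for s
        by (simp add: C_def sum_distrib_left mult.left_commute)
      show "integrable freq_measure (\<lambda>s. \<Phi> s * C s)"
        unfolding eq by (intro Bochner_Integration.integrable_sum integrable_mult_right \<Phi>_cos)
      have zero: "(LINT s|freq_measure. \<Phi> s * cos (dot s (z i - z i\<^sub>0))) = 0" if i: "i \<in> I - {i\<^sub>0}" for i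
      proof -
        obtain j where "real m \<le> \<bar>vec_nth (z i - z i\<^sub>0) j\<bar>"
          using sep[of i] i by blast
        then have "(LINT s|lborel. \<phi> s * cos (s * vec_nth (z i - z i\<^sub>0) j)) = 0"
          unfolding \<phi>_def by (rule sinc_power_fourier_vanishes[OF m(1)])
        then show ?thesis
          unfolding \<Phi>_cos by (intro prod_zero) auto
      qed
      have "(LINT s|freq_measure. \<Phi> s * C s) = (\<Sum>i\<in>I. a i * (LINT s|freq_measure. \<Phi> s * cos (dot s (z i - z i\<^sub>0))))"
        unfolding eq by (simp add: Bochner_Integration.integral_sum \<Phi>_cos(1))
      also have "\<dots> = a i\<^sub>0 * (LINT s|freq_measure. \<Phi> s * cos (dot s (z i\<^sub>0 - z i\<^sub>0)))"
        using I by (simp add: sum.remove zero)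
      also have "(LINT s|freq_measure. \<Phi> s * cos (dot s (z i\<^sub>0 - z i\<^sub>0))) = b"
        unfolding \<Phi>_cos by (simp add: b_def)
      finally show "(LINT s|freq_measure. \<Phi> s * C s) = a i\<^sub>0 * b" .
    qed
    have \<Psi>: "integrable freq_measure \<Psi>" "(LINT s|freq_measure. \<Psi> s) = J ^ CARD('d)"
      using fourier_cos_tensor[OF \<psi>, of "0 :: real ^ 'd"] by (simp_all add: \<Psi>_def[abs_def] J_def)
    have "(LINT s|freq_measure. 2 * \<theta> * (\<Phi> s * C s) - \<theta>\<^sup>2 * K * \<Psi> s) \<le> (LINT s|freq_measure. W s * T s)"
      by (intro integral_mono Bochner_Integration.integrable_diff integrable_mult_right \<Phi>C \<Psi> WT pointwise)
    also have "(LINT s|freq_measure. 2 * \<theta> * (\<Phi> s * C s) - \<theta>\<^sup>2 * K * \<Psi> s)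
        = 2 * \<theta> * (a i\<^sub>0 * b) - \<theta>\<^sup>2 * K * J ^ CARD('d)"
      by (simp only: Bochner_Integration.integral_diff integrable_mult_right integral_mult_right_zero \<Phi>C \<Psi>)
    finally have "2 * \<theta> * (a i\<^sub>0 * b) - \<theta>\<^sup>2 * (K * J ^ CARD('d)) \<le> Q"
      by (simp add: WT mult.assoc)
    moreover have "\<theta>\<^sup>2 * (K * J ^ CARD('d)) \<le> \<theta>\<^sup>2 * A"
      unfolding A_def using K J by (intro mult_left_mono power_mono) simp_all
    moreover have "2 * \<theta> * (a i\<^sub>0 * b) - \<theta>\<^sup>2 * A = (a i\<^sub>0 * b)\<^sup>2 / A"
      using A by (simp add: \<theta>_def field_simps power2_eq_square)
    moreover have "(a i\<^sub>0 * b)\<^sup>2 / A = c * \<alpha> powr \<nu> * (a i\<^sub>0)\<^sup>2"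
      using \<alpha> by (simp add: A_def K_def c_def powr_minus field_simps)
    ultimately show ?thesis
      unfolding Q_def by linarith
  qed
  show ?thesis
    by (intro exI[of _ "real m * real CARD('d)"] exI[of _ c] conjI allI impI main c)
qed

lemma matern_mix_scaleR: "matern_mix \<nu> \<alpha> (k *\<^sub>R z) = matern_mix \<nu> (\<alpha> * k\<^sup>2) z"
  by (simp add: matern_mix_def power_mult_distrib mult.assoc)

text \<open>
Rescaling the points by $\rho/\delta$ brings the separation up to the fixed radius of the previous
bound and changes the parameter $\alpha$ of the mixture by the factor $(\delta/\rho)^2$, whence the
power $\delta^{2\nu}$.
\<close>

lemma matern_quadratic_form_lower:
  fixes \<nu> l \<sigma> :: real
  assumes "0 < \<nu>" "0 < l" "\<sigma> \<noteq> 0"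
  shows "\<exists>c>0. \<forall>\<delta> I (y :: 'i \<Rightarrow> real ^ 'd) i\<^sub>0 a.
    0 < \<delta> \<longrightarrow> \<delta> \<le> 1 \<longrightarrow> isolated_at \<delta> I y i\<^sub>0
    \<longrightarrow> c * \<delta> powr (2 * \<nu>) * (a i\<^sub>0)\<^sup>2 \<le> quadratic_form (matern \<nu> \<sigma> l) I y a"
proof -
  define \<beta> where "\<beta> = \<nu> / (2 * l\<^sup>2)"
  have \<beta>: "0 < \<beta>" using assms by (simp add: \<beta>_def)
  obtain R c' where c': "0 < c'" and lower:
    "\<forall>\<alpha> I (z :: 'i \<Rightarrow> real ^ 'd) i\<^sub>0 a. 0 < \<alpha> \<longrightarrow> \<alpha> \<le> \<beta> \<longrightarrow> isolated_at R I z i\<^sub>0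
      \<longrightarrow> c' * \<alpha> powr \<nu> * (a i\<^sub>0)\<^sup>2 \<le> quadratic_form (\<lambda>p q. matern_mix \<nu> \<alpha> (p - q)) I z a"
    using matern_mix_quadratic_form_lower[OF assms(1) \<beta>] by (elim exE conjE) (rule that)
  \<comment> \<open>At least \<open>1\<close>, so that the points are dilated and the parameter of the mixture
    does not grow.\<close>
  define \<rho> where "\<rho> = max 1 R"
  have \<rho>: "1 \<le> \<rho>" "R \<le> \<rho>" by (simp_all add: \<rho>_def)
  define c where "c = \<sigma>\<^sup>2 * (c' * (\<beta> / \<rho>\<^sup>2) powr \<nu>)"
  have c: "0 < c"
    using assms c' \<beta> \<rho> by (simp add: c_def)
  have main: "c * \<delta> powr (2 * \<nu>) * (a i\<^sub>0)\<^sup>2 \<le> quadratic_form (matern \<nu> \<sigma> l) I y a"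
    if \<delta>: "0 < \<delta>" "\<delta> \<le> 1" and isolated: "isolated_at \<delta> I y i\<^sub>0"
    for \<delta> I and y :: "'i \<Rightarrow> real ^ 'd" and a i\<^sub>0
  proof -
    define k where "k = \<rho> / \<delta>"
    have k: "0 < k" "k * \<delta> = \<rho>" "1 \<le> k"
      using \<delta> \<rho> by (simp_all add: k_def le_divide_eq)
    have eq: "matern \<nu> \<sigma> l p q = \<sigma>\<^sup>2 * matern_mix \<nu> (\<beta> / k\<^sup>2) (k *\<^sub>R p - k *\<^sub>R q)" for p q :: "real ^ 'd"
      using k by (simp add: matern_eq_matern_mix[OF assms(1,2)] matern_mix_scaleR \<beta>_def flip: scaleR_diff_right)
    have "\<beta> * 1 \<le> \<beta> * k\<^sup>2"
      using \<beta> k by (intro mult_left_mono) simp_all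
    then have \<alpha>: "0 < \<beta> / k\<^sup>2" "\<beta> / k\<^sup>2 \<le> \<beta>"
      using \<beta> k by (simp_all add: divide_le_eq)
    have "R \<le> norm (k *\<^sub>R y i - k *\<^sub>R y i\<^sub>0)" if "\<delta> \<le> norm (y i - y i\<^sub>0)" for i
    proof -
      have "\<rho> \<le> k * norm (y i - y i\<^sub>0)"
        using mult_left_mono[OF that, of k] k by linarith
      then show ?thesis
        using k \<rho> by (simp flip: scaleR_diff_right)
    qed
    then have isolated': "isolated_at R I (\<lambda>i. k *\<^sub>R y i) i\<^sub>0"
      using isolated by (simp add: isolated_at_def)
    have "(\<beta> / \<rho>\<^sup>2) powr \<nu> * \<delta> powr (2 * \<nu>) = (\<beta> / k\<^sup>2) powr \<nu>"
    proof -
      have "\<delta> powr (2 * \<nu>) = (\<delta>\<^sup>2) powr \<nu>"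
        using \<delta> by (simp add: powr_powr flip: powr_numeral)
      moreover have "\<beta> / k\<^sup>2 = \<beta> / \<rho>\<^sup>2 * \<delta>\<^sup>2"
        by (simp add: k_def power_divide)
      ultimately show ?thesis
        using \<beta> by (simp add: powr_mult del: times_divide_eq_left)
    qed
    then have "c * \<delta> powr (2 * \<nu>) * (a i\<^sub>0)\<^sup>2 = \<sigma>\<^sup>2 * (c' * (\<beta> / k\<^sup>2) powr \<nu> * (a i\<^sub>0)\<^sup>2)"
      by (simp add: c_def mult.assoc)
    also have "\<dots> \<le> \<sigma>\<^sup>2 * quadratic_form (\<lambda>p q. matern_mix \<nu> (\<beta> / k\<^sup>2) (p - q)) I (\<lambda>i. k *\<^sub>R y i) a"
      by (rule mult_left_mono[OF lower[rule_format, OF \<alpha> isolated']]) simp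
    also have "\<dots> = quadratic_form (matern \<nu> \<sigma> l) I y a"
      by (simp add: quadratic_form_def eq sum_distrib_left mult_ac)
    finally show ?thesis .
  qed
  show ?thesis
    by (intro exI[of _ c] conjI allI impI main c)
qed

section \<open>The power function as a quadratic form\<close>

lemma kernel_mat_det_nonzero:
  assumes pos: "\<And>a. (\<exists>i<N. a i \<noteq> 0) \<Longrightarrow> quadratic_form k {..<N} x a \<noteq> 0"
  shows "Determinant.det (kernel_mat k N x) \<noteq> 0"
proof
  have A: "kernel_mat k N x \<in> carrier_mat N N" by (simp add: kernel_mat_def)
  assume "Determinant.det (kernel_mat k N x) = 0"
  then obtain v where v: "v \<in> carrier_vec N" "v \<noteq> 0\<^sub>v N" "kernel_mat k N x *\<^sub>v v = 0\<^sub>v N"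
    unfolding det_0_iff_vec_prod_zero_field[OF A] by blast
  have row: "(\<Sum>j<N. k (x i) (x j) * vec_index v j) = 0" if "i < N" for i
    using arg_cong[OF v(3), of "\<lambda>w. vec_index w i"] that v(1)
    by (simp add: kernel_mat_def scalar_prod_def lessThan_atLeast0)
  have "quadratic_form k {..<N} x (vec_index v)
      = (\<Sum>i<N. vec_index v i * (\<Sum>j<N. k (x i) (x j) * vec_index v j))"
    by (simp add: quadratic_form_def sum_distrib_left mult_ac)
  also have "\<dots> = 0" by (simp add: row)
  finally have "\<forall>i<N. vec_index v i = 0"
    using pos[of "vec_index v"] by blast
  then have "v = 0\<^sub>v N" using v(1) by (intro eq_vecI) auto
  with v(2) show False by simp
qed

text \<open>
The squared power function is the squared norm of the error functional of interpolation at $t$. Its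
coefficients are $1$ at $t$ and minus those of the kernel interpolant at the design points; the
point $t$ is appended as number $N$.
\<close>

lemma power_function_sq_eq_quadratic_form:
  assumes det: "Determinant.det (kernel_mat k N x) \<noteq> 0"
    and sym: "\<And>p q. k p q = k q p"
  obtains a where "a N = 1"
    "power_function_sq k N x t = quadratic_form k {..<Suc N} (x(N := t)) a"
proof -
  define A where "A = kernel_mat k N x"
  define u where "u = kernel_vec k N x t"
  have A: "A \<in> carrier_mat N N" and u: "u \<in> carrier_vec N"
    by (simp_all add: A_def kernel_mat_def u_def kernel_vec_def)
  have "mat_inverse A \<noteq> None"
    using mat_inverse(1)[OF A, where b = "()"] det_non_zero_imp_unit[OF A, where b = "()"] det
    unfolding A_def by blast
  then obtain A' where A'_eq: "mat_inverse A = Some A'" by blast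
  then have A': "A * A' = 1\<^sub>m N" "A' \<in> carrier_mat N N"
    using mat_inverse(2)[OF A] by blast+
  define b where "b = A' *\<^sub>v u"
  have b: "b \<in> carrier_vec N"
    unfolding b_def using A'(2) u by (rule mult_mat_vec_carrier)
  have Ab: "A *\<^sub>v b = u"
    unfolding b_def using A A' u by (simp flip: assoc_mult_mat_vec)
  have row: "(\<Sum>j<N. k (x i) (x j) * vec_index b j) = k t (x i)" if "i < N" for i
    using arg_cong[OF Ab, of "\<lambda>w. vec_index w i"] that b
    by (simp add: A_def kernel_mat_def u_def kernel_vec_def scalar_prod_def lessThan_atLeast0)
  define s where "s = (\<Sum>i<N. vec_index b i * k t (x i))"
  have P: "power_function_sq k N x t = k t t - s"
    using b unfolding power_function_sq_def A_def[symmetric] u_def[symmetric] A'_eq option.sel b_def[symmetric]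
    by (simp add: scalar_prod_def u_def kernel_vec_def s_def lessThan_atLeast0 mult.commute)
  define a where "a i = (if i < N then - vec_index b i else 1)" for i
  have "(\<Sum>i<N. \<Sum>j<N. a i * a j * k (x i) (x j))
      = (\<Sum>i<N. vec_index b i * (\<Sum>j<N. k (x i) (x j) * vec_index b j))"
    by (simp add: a_def sum_distrib_left mult_ac)
  also have "\<dots> = s" by (simp add: row s_def)
  finally have quad: "(\<Sum>i<N. \<Sum>j<N. a i * a j * k (x i) (x j)) = s" .
  have cross: "(\<Sum>i<N. a i * k t (x i)) = - s"
    by (simp add: a_def s_def sum_negf)
  have "a N = 1" by (simp add: a_def)
  then have "quadratic_form k {..<Suc N} (x(N := t)) a
      = (\<Sum>i<N. \<Sum>j<N. a i * a j * k (x i) (x j)) + (\<Sum>i<N. a i * k (x i) t) + (\<Sum>i<N. a i * k t (x i)) + k t t"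
    by (simp add: quadratic_form_def sum.distrib)
  also have "(\<Sum>i<N. a i * k (x i) t) = (\<Sum>i<N. a i * k t (x i))"
    by (simp only: sym[of "x _" t])
  finally have "quadratic_form k {..<Suc N} (x(N := t)) a = s + - s + - s + k t t"
    unfolding quad cross .
  then have "power_function_sq k N x t = quadratic_form k {..<Suc N} (x(N := t)) a"
    using P by linarith
  then show ?thesis
    using \<open>a N = 1\<close> by (intro that[of a]) simp_all
qed

lemma matern_sym: "matern \<nu> \<sigma> l p q = matern \<nu> \<sigma> l q p"
  by (simp add: matern_def norm_minus_commute)

text \<open>
Strict positive definiteness: in a finite set of distinct points every point is isolated at some
scale $\delta$, and the lower bound for the quadratic form applies around a point with nonzero
coefficient.
\<close>

lemma matern_kernel_mat_det_nonzero:
  fixes x :: "nat \<Rightarrow> real ^ 'd"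
  assumes "0 < \<nu>" "0 < l" "\<sigma> \<noteq> 0" and inj: "inj_on x {..<N}"
  shows "Determinant.det (kernel_mat (matern \<nu> \<sigma> l) N x) \<noteq> 0"
proof (rule kernel_mat_det_nonzero)
  fix a :: "nat \<Rightarrow> real"
  assume "\<exists>i<N. a i \<noteq> 0"
  then obtain i\<^sub>0 where i\<^sub>0: "i\<^sub>0 < N" "a i\<^sub>0 \<noteq> 0" by blast
  obtain c where c: "0 < c" and lower: "\<forall>\<delta> I (y :: nat \<Rightarrow> real ^ 'd) i\<^sub>0 a. 0 < \<delta> \<longrightarrow> \<delta> \<le> 1
      \<longrightarrow> isolated_at \<delta> I y i\<^sub>0
      \<longrightarrow> c * \<delta> powr (2 * \<nu>) * (a i\<^sub>0)\<^sup>2 \<le> quadratic_form (matern \<nu> \<sigma> l) I y a"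
    using matern_quadratic_form_lower[OF assms(1-3)] by (elim exE conjE) (rule that)
  define \<delta> where "\<delta> = Min (insert 1 ((\<lambda>i. norm (x i - x i\<^sub>0)) ` ({..<N} - {i\<^sub>0})))"
  have "0 < \<delta>"
    using inj i\<^sub>0 by (auto simp: \<delta>_def inj_on_def)
  moreover have "\<delta> \<le> 1" by (simp add: \<delta>_def)
  moreover have "\<delta> \<le> norm (x i - x i\<^sub>0)" if "i < N" "i \<noteq> i\<^sub>0" for i
    unfolding \<delta>_def using that by (intro Min_le) auto
  then have "isolated_at \<delta> {..<N} x i\<^sub>0"
    using i\<^sub>0 by (simp add: isolated_at_def)
  ultimately have "c * \<delta> powr (2 * \<nu>) * (a i\<^sub>0)\<^sup>2 \<le> quadratic_form (matern \<nu> \<sigma> l) {..<N} x a"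
    by (rule lower[rule_format])
  moreover have "0 < c * \<delta> powr (2 * \<nu>) * (a i\<^sub>0)\<^sup>2"
    using c \<open>0 < \<delta>\<close> i\<^sub>0 by simp
  ultimately show "quadratic_form (matern \<nu> \<sigma> l) {..<N} x a \<noteq> 0"
    by linarith
qed

section \<open>The fill distance and the lower bound for the power function\<close>

lemma min_dist_le: "i < N \<Longrightarrow> min_dist N x t \<le> norm (t - x i)"
  unfolding min_dist_def by (intro Min_le) auto

lemma fill_distance_cube_pos:
  fixes x :: "nat \<Rightarrow> real ^ 'd"
  assumes "0 < B" "1 \<le> N"
  shows "0 < fill_distance (cube B) N x"
proof -
  have bdd: "bdd_above (min_dist N x ` cube B)"
  proof -
    obtain r where r: "\<And>t. t \<in> cube B \<Longrightarrow> norm (t :: real ^ 'd) \<le> r"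
      using bounded_box unfolding cube_def bounded_iff by blast
    have "min_dist N x t \<le> r + norm (x 0)" if "t \<in> cube B" for t
      using min_dist_le[of 0 N x t] norm_triangle_ineq4[of t "x 0"] r[OF that] assms(2) by linarith
    then show ?thesis by (rule bdd_aboveI2)
  qed
  have "(0 :: real ^ 'd) \<in> cube B"
    using assms(1) by (simp add: cube_def mem_box_cart)
  then have "infinite (cube B :: (real ^ 'd) set)"
    unfolding cube_def using finite_imp_not_open[OF _ open_box] by blast
  then obtain t where t: "t \<in> cube B" "t \<notin> x ` {..<N}"
    by (metis finite_imageI finite_lessThan finite_subset subsetI)
  have "0 < min_dist N x t"
    using t assms(2) by (auto simp: min_dist_def lessThan_empty_iff)
  also have "\<dots> \<le> fill_distance (cube B) N x"
    unfolding fill_distance_def by (rule cSUP_upper[OF t(1) bdd])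
  finally show ?thesis .
qed

theorem theorem7:
  fixes B :: real
  assumes "B > 0"
  shows "\<exists>h0 > 0. \<forall>\<sigma> l \<nu> \<gamma> :: real.
           \<sigma>\<^sup>2 > 0 \<and> l > 0 \<and> \<nu> > real CARD('d) / 2 \<and> 0 < \<gamma> \<and> \<gamma> < 1 \<longrightarrow>
           (\<exists>c > 0. \<forall>(N :: nat) (x :: nat \<Rightarrow> real ^ 'd) (t :: real ^ 'd).
              N \<ge> 1 \<and> inj_on x {..<N} \<and> x ` {..<N} \<subseteq> cube B
              \<and> fill_distance (cube B) N x \<le> h0
              \<and> t \<in> cube B \<and> min_dist N x t \<ge> \<gamma> * fill_distance (cube B) N x
              \<longrightarrow> power_function_sq (matern \<nu> \<sigma> l) N x t
                    \<ge> c * fill_distance (cube B) N x powr (2 * \<nu>))"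
proof (rule exI[of _ 1], intro conjI allI impI; (elim conjE)?)
  fix \<sigma> l \<nu> \<gamma> :: real
  assume "0 < \<sigma>\<^sup>2" and l: "0 < l" and \<nu>: "real CARD('d) / 2 < \<nu>" and \<gamma>: "0 < \<gamma>" "\<gamma> < 1"
  then have \<sigma>: "\<sigma> \<noteq> 0" by simp
  have \<nu>_pos: "0 < \<nu>"
    by (rule le_less_trans[OF _ \<nu>]) simp
  obtain c where c: "0 < c" and lower: "\<forall>\<delta> I (y :: nat \<Rightarrow> real ^ 'd) i\<^sub>0 a. 0 < \<delta> \<longrightarrow> \<delta> \<le> 1
      \<longrightarrow> isolated_at \<delta> I y i\<^sub>0
      \<longrightarrow> c * \<delta> powr (2 * \<nu>) * (a i\<^sub>0)\<^sup>2 \<le> quadratic_form (matern \<nu> \<sigma> l) I y a"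
    using matern_quadratic_form_lower[OF \<nu>_pos l \<sigma>] by (elim exE conjE) (rule that)
  show "\<exists>c > 0. \<forall>(N :: nat) (x :: nat \<Rightarrow> real ^ 'd) (t :: real ^ 'd).
              N \<ge> 1 \<and> inj_on x {..<N} \<and> x ` {..<N} \<subseteq> cube B
              \<and> fill_distance (cube B) N x \<le> 1
              \<and> t \<in> cube B \<and> min_dist N x t \<ge> \<gamma> * fill_distance (cube B) N x
              \<longrightarrow> power_function_sq (matern \<nu> \<sigma> l) N x t
                    \<ge> c * fill_distance (cube B) N x powr (2 * \<nu>)"
  proof (rule exI[of _ "c * \<gamma> powr (2 * \<nu>)"], intro conjI allI impI; (elim conjE)?)
    show "0 < c * \<gamma> powr (2 * \<nu>)" using c \<gamma> by simp
    fix N and x :: "nat \<Rightarrow> real ^ 'd" and t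
    assume N: "1 \<le> N" and inj: "inj_on x {..<N}" and h_le: "fill_distance (cube B) N x \<le> 1"
      and sep: "\<gamma> * fill_distance (cube B) N x \<le> min_dist N x t"
    define h where "h = fill_distance (cube B) N x"
    have h: "0 < h" "h \<le> 1"
      using fill_distance_cube_pos[OF assms N] h_le by (simp_all add: h_def)
    obtain a where a: "a N = 1"
        "power_function_sq (matern \<nu> \<sigma> l) N x t = quadratic_form (matern \<nu> \<sigma> l) {..<Suc N} (x(N := t)) a"
      using power_function_sq_eq_quadratic_form[OF
          matern_kernel_mat_det_nonzero[OF \<nu>_pos l \<sigma> inj] matern_sym] by blast
    have "\<gamma> * h \<le> norm (x i - t)" if "i < N" for i
      using sep min_dist_le[OF that, of x t] by (simp add: h_def norm_minus_commute)
    then have "isolated_at (\<gamma> * h) {..<Suc N} (x(N := t)) N"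
      by (simp add: isolated_at_def)
    moreover have "0 < \<gamma> * h" "\<gamma> * h \<le> 1"
      using \<gamma> h by (simp_all add: mult_le_one)
    ultimately have "c * (\<gamma> * h) powr (2 * \<nu>) * (a N)\<^sup>2 \<le> power_function_sq (matern \<nu> \<sigma> l) N x t"
      unfolding a(2) by (intro lower[rule_format])
    then show "c * \<gamma> powr (2 * \<nu>) * fill_distance (cube B) N x powr (2 * \<nu>)
        \<le> power_function_sq (matern \<nu> \<sigma> l) N x t"
      using \<gamma> h by (simp add: a(1) powr_mult mult.assoc flip: h_def)
  qed
qed simp

end
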